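(* Let $(V_1,V_2)$ be a pair of commuting isometries on a Hilbert space $\mathcal H$ with $C(V_1,V_2)=0$ and $\ker(V_1V_2)^*\neq\{0\}$. Let $(\mathcal E,P,U)$ be the BCL triple with associated functions $\varphi_1,\varphi_2$, and let $U_1=U|_{\operatorname{ran}P}$, $U_2=U|_{\operatorname{ran}P^\perp}$ (these subspaces reduce $U$). Then $$\sigma(M_{\varphi_1},M_{\varphi_2})=\overline{\bigcup_{z\in\mathbb D}\sigma(\varphi_1(z),\varphi_2(z))}=\begin{cases}\overline{\mathbb D}\times\sigma(U_1)&\text{if }V_2\text{ is a unitary},\\ \sigma(U_2^* )\times\overline{\mathbb D}&\text{if }V_1\text{ is a unitary},\\ \overline{\mathbb D}\times\sigma(U_1)\cup\sigma(U_2^* )\times\overline{\mathbb D}&\text{otherwise},\end{cases}$$ and for every point $(z_1,z_2)$ in $\mathbb D\times\sigma(U_1)$ (if $V_2$ is a unitary), in $\sigma(U_2^* )\times\mathbb D$ (if $V_1$ is a unitary), or in $\mathbb D\times\sigma(U_1)\cup\sigma(U_2^* )\times\mathbb D$ (otherwise), the non-singularity of the Koszul complex of $(M_{\varphi_1}-z_1I,M_{\varphi_2}-z_2I)$ breaks at stage 3.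
   Context: Defect operator: $C(V_1,V_2)=I-V_1V_1^*-V_2V_2^*+V_1V_2V_2^*V_1^*$. Given a Hilbert space $\mathcal E$, a projection $P$ and unitary $U$ on $\mathcal E$, set $P^\perp=I-P$, $\varphi_1(z)=U^*(P^\perp+zP)$, $\varphi_2(z)=(P+zP^\perp)U$ ($z\in\mathbb D$), and let $M_{\varphi_i}$ be the multiplication operators on the $\mathcal E$-valued Hardy space $H^2_{\mathbb D}(\mathcal E)$. Berger–Coburn–Lebow theorem: for commuting isometries $(V_1,V_2)$ on $\mathcal H$, $\mathcal H=\mathcal H_p\oplus\mathcal H_u$ (jointly reducing), $V_i|_{\mathcal H_u}$ commuting unitaries, and there is a triple $(\mathcal E,P,U)$, unique up to unitary equivalence, with $(V_1|_{\mathcal H_p},V_2|_{\mathcal H_p})$ unitarily equal to $(M_{\varphi_1},M_{\varphi_2})$ ($\mathcal E\cong\ker(V_1V_2)^*$); this is the BCL triple. Koszul complex of commuting $T_1,T_2$: $0\to\mathcal H\xrightarrow{\delta_1}\mathcal H\oplus\mathcal H\xrightarrow{\delta_2}\mathcal H\to0$, $\delta_1h=(T_1h,T_2h)$, $\delta_2(h_1,h_2)=T_1h_2-T_2h_1$; $\sigma(T_1,T_2)$ is the Taylor joint spectrum; breaking at stage 3 means $\operatorname{ran}(T_1-\lambda_1)+\operatorname{ran}(T_2-\lambda_2)\ne\mathcal H$. *)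

theory Defs
  imports "HOL-Analysis.Analysis" "HOL-Library.Function_Algebras"
begin

class chilbert = banach +
  fixes scaleC :: "complex \<Rightarrow> 'a \<Rightarrow> 'a" (infixr \<open>*\<^sub>C\<close> 75)
    and cinner :: "'a \<Rightarrow> 'a \<Rightarrow> complex"
  assumes scaleC_add_right: "a *\<^sub>C (x + y) = a *\<^sub>C x + a *\<^sub>C y"
    and scaleC_add_left: "(a + b) *\<^sub>C x = a *\<^sub>C x + b *\<^sub>C x"
    and scaleC_scaleC: "a *\<^sub>C (b *\<^sub>C x) = (a * b) *\<^sub>C x"
    and scaleC_one: "1 *\<^sub>C x = x"
    and scaleR_scaleC: "scaleR r x = complex_of_real r *\<^sub>C x"
    and cinner_add_right: "cinner x (y + z) = cinner x y + cinner x z"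
    and cinner_scaleC_right: "cinner x (a *\<^sub>C y) = a * cinner x y"
    and cinner_commute: "cinner y x = cnj (cinner x y)"
    and norm_cinner: "norm x = sqrt (Re (cinner x x))"

definition bcl :: "('a::chilbert \<Rightarrow> 'b::chilbert) \<Rightarrow> bool" where
  "bcl T \<longleftrightarrow> bounded_linear T \<and> (\<forall>c x. T (c *\<^sub>C x) = c *\<^sub>C T x)"

definition adj :: "('a::chilbert \<Rightarrow> 'b::chilbert) \<Rightarrow> 'b \<Rightarrow> 'a" where
  "adj T = (SOME S. \<forall>x y. cinner (T x) y = cinner x (S y))"

definition isometry :: "('a::chilbert \<Rightarrow> 'a) \<Rightarrow> bool" where
  "isometry V \<longleftrightarrow> bcl V \<and> (\<forall>x. norm (V x) = norm x)"

definition unitary :: "('a::chilbert \<Rightarrow> 'a) \<Rightarrow> bool" where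
  "unitary U \<longleftrightarrow> isometry U \<and> surj U"

definition orth_proj :: "('a::chilbert \<Rightarrow> 'a) \<Rightarrow> bool" where
  "orth_proj P \<longleftrightarrow> bcl P \<and> (\<forall>x. P (P x) = P x) \<and> (\<forall>x y. cinner (P x) y = cinner x (P y))"

definition csubspace :: "'a::chilbert set \<Rightarrow> bool" where
  "csubspace M \<longleftrightarrow> 0 \<in> M \<and> (\<forall>x\<in>M. \<forall>y\<in>M. x + y \<in> M) \<and> (\<forall>c. \<forall>x\<in>M. c *\<^sub>C x \<in> M) \<and> closed M"

definition orth_compl :: "'a::chilbert set \<Rightarrow> 'a set" where
  "orth_compl M = {x. \<forall>y\<in>M. cinner y x = 0}"

definition reduces :: "'a::chilbert set \<Rightarrow> ('a \<Rightarrow> 'a) \<Rightarrow> bool" where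
  "reduces M T \<longleftrightarrow> T ` M \<subseteq> M \<and> adj T ` M \<subseteq> M"

definition defect_op :: "('a::chilbert \<Rightarrow> 'a) \<Rightarrow> ('a \<Rightarrow> 'a) \<Rightarrow> 'a \<Rightarrow> 'a" where
  "defect_op V1 V2 = (\<lambda>x. x - V1 (adj V1 x) - V2 (adj V2 x) + V1 (V2 (adj V2 (adj V1 x))))"

definition spec_on :: "'a::chilbert set \<Rightarrow> ('a \<Rightarrow> 'a) \<Rightarrow> complex set" where
  "spec_on M T = {c. \<not> bij_betw (\<lambda>x. T x - c *\<^sub>C x) M M}"

definition koszul_exact_on :: "'v::ab_group_add set \<Rightarrow> ('v \<Rightarrow> 'v) \<Rightarrow> ('v \<Rightarrow> 'v) \<Rightarrow> bool" where
  "koszul_exact_on X T1 T2 \<longleftrightarrow>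
     inj_on (\<lambda>h. (T1 h, T2 h)) X \<and>
     {(h1, h2). h1 \<in> X \<and> h2 \<in> X \<and> T1 h2 - T2 h1 = 0} = (\<lambda>h. (T1 h, T2 h)) ` X \<and>
     (\<lambda>(h1, h2). T1 h2 - T2 h1) ` (X \<times> X) = X"

definition joint_spec_on :: "(complex \<Rightarrow> 'v \<Rightarrow> 'v) \<Rightarrow> 'v::ab_group_add set \<Rightarrow> ('v \<Rightarrow> 'v) \<Rightarrow> ('v \<Rightarrow> 'v)
    \<Rightarrow> (complex \<times> complex) set" where
  "joint_spec_on sc X T1 T2 =
     {(z1, z2). \<not> koszul_exact_on X (\<lambda>x. T1 x - sc z1 x) (\<lambda>x. T2 x - sc z2 x)}"

definition taylor_spec :: "('a::chilbert \<Rightarrow> 'a) \<Rightarrow> ('a \<Rightarrow> 'a) \<Rightarrow> (complex \<times> complex) set" where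
  "taylor_spec T1 T2 = joint_spec_on scaleC UNIV T1 T2"

definition koszul_breaks_stage3_on :: "'v::ab_group_add set \<Rightarrow> ('v \<Rightarrow> 'v) \<Rightarrow> ('v \<Rightarrow> 'v) \<Rightarrow> bool" where
  "koszul_breaks_stage3_on X T1 T2 \<longleftrightarrow> {T1 a + T2 b | a b. a \<in> X \<and> b \<in> X} \<noteq> X"

definition hardy_coeffs :: "(complex \<Rightarrow> 'e::chilbert) \<Rightarrow> (nat \<Rightarrow> 'e) \<Rightarrow> bool" where
  "hardy_coeffs f a \<longleftrightarrow> summable (\<lambda>n. (norm (a n))\<^sup>2) \<and>
     (\<forall>z\<in>ball 0 1. f z = (\<Sum>n. (z ^ n) *\<^sub>C a n)) \<and> (\<forall>z. z \<notin> ball 0 1 \<longrightarrow> f z = 0)"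

definition hardy2 :: "(complex \<Rightarrow> 'e::chilbert) set" where
  "hardy2 = {f. \<exists>a. hardy_coeffs f a}"

definition hardy_norm :: "(complex \<Rightarrow> 'e::chilbert) \<Rightarrow> real" where
  "hardy_norm f = sqrt (\<Sum>n. (norm ((SOME a. hardy_coeffs f a) n))\<^sup>2)"

definition fscaleC :: "complex \<Rightarrow> (complex \<Rightarrow> 'e::chilbert) \<Rightarrow> complex \<Rightarrow> 'e" where
  "fscaleC c f = (\<lambda>z. c *\<^sub>C f z)"

definition mult_op :: "(complex \<Rightarrow> 'e \<Rightarrow> 'e::chilbert) \<Rightarrow> (complex \<Rightarrow> 'e) \<Rightarrow> complex \<Rightarrow> 'e" where
  "mult_op \<phi> f = (\<lambda>z. if z \<in> ball 0 1 then \<phi> z (f z) else 0)"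

definition phi1 :: "('e::chilbert \<Rightarrow> 'e) \<Rightarrow> ('e \<Rightarrow> 'e) \<Rightarrow> complex \<Rightarrow> 'e \<Rightarrow> 'e" where
  "phi1 P U z = (\<lambda>x. adj U ((x - P x) + z *\<^sub>C P x))"

definition phi2 :: "('e::chilbert \<Rightarrow> 'e) \<Rightarrow> ('e \<Rightarrow> 'e) \<Rightarrow> complex \<Rightarrow> 'e \<Rightarrow> 'e" where
  "phi2 P U z = (\<lambda>x. P (U x) + z *\<^sub>C (U x - P (U x)))"

text \<open>(E,P,U) is a BCL triple for the commuting isometries (V1,V2): H = Hp (+) Hu with Hp, Hu
  jointly reducing, V_i restricted to Hu unitary, and (V1|Hp, V2|Hp) unitarily equivalent
  (via W) to (M_phi1, M_phi2) on H^2_D(E).\<close>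
definition bcl_triple :: "('h::chilbert \<Rightarrow> 'h) \<Rightarrow> ('h \<Rightarrow> 'h) \<Rightarrow> ('e::chilbert \<Rightarrow> 'e) \<Rightarrow> ('e \<Rightarrow> 'e) \<Rightarrow> bool" where
  "bcl_triple V1 V2 P U \<longleftrightarrow> orth_proj P \<and> unitary U \<and>
     (\<exists>Hp Hu (W :: 'h \<Rightarrow> complex \<Rightarrow> 'e).
        csubspace Hp \<and> Hu = orth_compl Hp \<and>
        reduces Hp V1 \<and> reduces Hp V2 \<and> reduces Hu V1 \<and> reduces Hu V2 \<and>
        bij_betw V1 Hu Hu \<and> bij_betw V2 Hu Hu \<and>
        bij_betw W Hp hardy2 \<and>
        (\<forall>x\<in>Hp. \<forall>y\<in>Hp. W (x + y) = W x + W y) \<and>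
        (\<forall>c. \<forall>x\<in>Hp. W (c *\<^sub>C x) = fscaleC c (W x)) \<and>
        (\<forall>x\<in>Hp. hardy_norm (W x) = norm x) \<and>
        (\<forall>x\<in>Hp. W (V1 x) = mult_op (phi1 P U) (W x)) \<and>
        (\<forall>x\<in>Hp. W (V2 x) = mult_op (phi2 P U) (W x)))"

end

theory Submission
  imports Defs
begin

text \<open>In the BCL model the defect operator acts on constants as \<open>U\<^sup>* P U - P\<close>, so it vanishes only
  if \<open>P\<close> commutes with \<open>U\<close>. Then \<open>E = ran P \<oplus> ran P'\<close> splits both symbols:
  \<open>(\<phi>\<^sub>1(z), \<phi>\<^sub>2(z))\<close> is \<open>(z V\<^sup>*, V)\<close> on \<open>ran P\<close> with \<open>V = U\<close>, and \<open>(V, z V\<^sup>*)\<close> on \<open>ran P'\<close> with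
  \<open>V = U\<^sup>*\<close>. For such a pair at \<open>(\<zeta>, \<lambda>)\<close>: if \<open>\<lambda> \<notin> \<sigma>(V)\<close> or \<open>\<bar>\<zeta>\<bar> > 1\<close>, one of the
  two operators is invertible and the Koszul complex is exact. If \<open>\<lambda> \<in> \<sigma>(V)\<close> and \<open>\<bar>\<zeta>\<bar> < 1\<close>,
  evaluation at \<open>z = \<zeta> \<lambda>\<close> turns \<open>z V\<^sup>* - \<zeta>\<close> into \<open>- \<zeta> V\<^sup>* (V - \<lambda>)\<close>, so stage 3 would make
  \<open>V - \<lambda>\<close> surjective. For \<open>\<bar>\<zeta>\<bar> = 1\<close> evaluation along a sequence tending to \<open>\<zeta> \<lambda>\<close>, the growth
  bound of the Hardy space and the uniform boundedness principle lead to the same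
  contradiction.\<close>

subsection \<open>Hilbert space preliminaries\<close>

text \<open>The gap between the open-disc set seen by the fibres and the closed-disc set seen by the
  Hardy space is one of uniformity: at a point \<open>w\<close> of the disc, \<open>w V' - z\<close>
  is bounded below by \<open>cmod z - cmod w\<close>, which is positive as soon as
  \<open>cmod z \<ge> 1\<close> but tends to 0 at the boundary when \<open>cmod z = 1\<close>. A
  single pair of inverse families therefore serves both spectra: it exists at every point outside
  the open-disc set, and its action on the Hardy space is claimed only outside the closed-disc set.
  Every obstruction is a failure of surjectivity, so stage 3 alone decides exactness, boundary
  points included. This rests on normality: on a reducing subspace a spectral value of a unitary
  makes \<open>V - l\<close> both not bounded below and not surjective. The three cases are one
  formula: if \<open>V2\<close> (or \<open>V1\<close>) is surjective, the complement of
  \<open>ran P\<close> (or \<open>ran P\<close>) is zero, and the spectrum over the zero space is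
  empty.\<close>

lemma scaleC_zero_left [simp]: "0 *\<^sub>C x = (0::'a::chilbert)"
  using scaleC_add_left[of 0 0 x] by simp

lemma scaleC_zero_right [simp]: "c *\<^sub>C 0 = (0::'a::chilbert)"
  using scaleC_add_right[of c 0 0] by simp

lemma scaleC_minus_left [simp]: "(- c) *\<^sub>C x = - (c *\<^sub>C (x::'a::chilbert))"
  using scaleC_add_left[of "- c" c x] by (simp add: eq_neg_iff_add_eq_0)

lemma scaleC_minus_right [simp]: "c *\<^sub>C (- x) = - (c *\<^sub>C (x::'a::chilbert))"
  using scaleC_add_right[of c "- x" x] by (simp add: eq_neg_iff_add_eq_0)

lemma scaleC_diff_left: "(a - b) *\<^sub>C x = a *\<^sub>C x - b *\<^sub>C (x::'a::chilbert)"
  using scaleC_add_left[of a "- b" x] by simp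

lemma scaleC_diff_right: "c *\<^sub>C (x - y) = c *\<^sub>C x - c *\<^sub>C (y::'a::chilbert)"
  using scaleC_add_right[of c x "- y"] by simp

declare scaleC_scaleC [simp] scaleC_one [simp]

lemmas scaleC_simps = scaleC_add_left scaleC_add_right scaleC_diff_left scaleC_diff_right

lemma cinner_add_left: "cinner (x + y) z = cinner x z + cinner (y::'a::chilbert) z"
  by (metis cinner_add_right cinner_commute complex_cnj_add)

lemma cinner_scaleC_left: "cinner (c *\<^sub>C x) y = cnj c * cinner x (y::'a::chilbert)"
  by (metis cinner_scaleC_right cinner_commute complex_cnj_mult)

lemma cinner_zero_right [simp]: "cinner x (0::'a::chilbert) = 0"
  using cinner_add_right[of x 0 0] by simp

lemma cinner_zero_left [simp]: "cinner (0::'a::chilbert) x = 0"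
  using cinner_add_left[of 0 0 x] by simp

lemma cinner_minus_right [simp]: "cinner x (- y) = - cinner x (y::'a::chilbert)"
  using cinner_add_right[of x "- y" y] by (simp add: eq_neg_iff_add_eq_0)

lemma cinner_minus_left [simp]: "cinner (- x) y = - cinner x (y::'a::chilbert)"
  using cinner_add_left[of "- x" x y] by (simp add: eq_neg_iff_add_eq_0)

lemma cinner_diff_right: "cinner x (y - z) = cinner x y - cinner x (z::'a::chilbert)"
  using cinner_add_right[of x y "- z"] by simp

lemma cinner_diff_left: "cinner (x - y) z = cinner x z - cinner (y::'a::chilbert) z"
  using cinner_add_left[of x "- y" z] by simp

lemmas cinner_simps = cinner_add_left cinner_add_right cinner_diff_left cinner_diff_right
  cinner_scaleC_left cinner_scaleC_right

lemma cinner_self: "cinner x x = complex_of_real ((norm (x::'a::chilbert))\<^sup>2)"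
proof -
  have "sqrt (Re (cinner x x)) \<ge> 0"
    using norm_cinner[of x] by (metis norm_ge_zero)
  then have "Re (cinner x x) = (norm x)\<^sup>2"
    by (simp add: norm_cinner)
  moreover have "Im (cinner x x) = 0"
    using arg_cong[OF cinner_commute[of x x], of Im] by simp
  ultimately show ?thesis
    by (simp add: complex_eq_iff)
qed

lemma cinner_eq_zero_iff: "cinner x x = 0 \<longleftrightarrow> x = (0::'a::chilbert)"
  by (simp add: cinner_self)

lemma norm_sq_cinner: "(norm x)\<^sup>2 = Re (cinner x (x::'a::chilbert))"
  by (simp add: cinner_self)

lemma Re_cinner_commute: "Re (cinner y x) = Re (cinner x (y::'a::chilbert))"
  by (subst cinner_commute) simp

lemma norm_add_sq: "(norm (x + y))\<^sup>2 = (norm x)\<^sup>2 + (norm (y::'a::chilbert))\<^sup>2 + 2 * Re (cinner x y)"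
  by (simp add: norm_sq_cinner cinner_simps Re_cinner_commute[of y x])

lemma norm_scaleC: "norm (c *\<^sub>C x) = cmod c * norm (x::'a::chilbert)"
proof -
  have "complex_of_real ((norm (c *\<^sub>C x))\<^sup>2) = c * cnj c * complex_of_real ((norm x)\<^sup>2)"
    by (simp only: cinner_self[symmetric] cinner_simps) (simp add: mult_ac)
  also have "\<dots> = complex_of_real ((cmod c * norm x)\<^sup>2)"
    by (simp add: complex_norm_square[symmetric] power_mult_distrib)
  finally have "(norm (c *\<^sub>C x))\<^sup>2 = (cmod c * norm x)\<^sup>2"
    using of_real_eq_iff by blast
  then show ?thesis
    by (simp add: power2_eq_iff_nonneg)
qed

lemma norm_cinner_le: "cmod (cinner x y) \<le> norm x * norm (y::'a::chilbert)"
proof (cases "y = 0")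
  case False
  define c where "c = cinner y x / (norm y)\<^sup>2"
  have "(norm (x - c *\<^sub>C y))\<^sup>2 = (norm x)\<^sup>2 + (cmod c)\<^sup>2 * (norm y)\<^sup>2 - 2 * Re (c * cinner x y)"
    using norm_add_sq[of x "- (c *\<^sub>C y)"]
    by (simp add: norm_scaleC cinner_simps power_mult_distrib)
  also have "c * cinner x y = complex_of_real ((cmod (cinner x y))\<^sup>2 / (norm y)\<^sup>2)"
    unfolding c_def by (subst cinner_commute) (simp add: mult.commute complex_norm_square[symmetric])
  also have "(cmod c)\<^sup>2 * (norm y)\<^sup>2 = (cmod (cinner x y))\<^sup>2 / (norm y)\<^sup>2"
    unfolding c_def using False cinner_commute[of y x]
    by (simp add: norm_divide power_divide power2_eq_square norm_mult)
  finally have "0 \<le> (norm x)\<^sup>2 - (cmod (cinner x y))\<^sup>2 / (norm y)\<^sup>2"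
    by (smt (verit) Re_complex_of_real zero_le_power2)
  then have "(cmod (cinner x y))\<^sup>2 \<le> (norm x * norm y)\<^sup>2"
    using False by (simp add: field_simps power_mult_distrib)
  then show ?thesis
    by (rule power2_le_imp_le) simp
qed simp

lemma bounded_linear_scaleC_right: "bounded_linear (\<lambda>x::'a::chilbert. c *\<^sub>C x)"
  by (rule bounded_linear_intro[where K = "cmod c"])
    (simp_all add: scaleC_add_right norm_scaleC scaleR_scaleC mult.commute)

lemma bounded_linear_cinner_right: "bounded_linear (\<lambda>y::'a::chilbert. cinner x y)"
  by (rule bounded_linear_intro[where K = "norm x"])
    (simp_all add: cinner_simps scaleR_scaleC norm_cinner_le mult.commute[of _ "norm x"] scaleR_conv_of_real)

section \<open>Bounded complex-linear operators and their adjoints\<close>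

lemma cinner_eqI: "(\<And>x. cinner x y = cinner x z) \<Longrightarrow> y = (z::'a::chilbert)"
  using cinner_eq_zero_iff[of "y - z"] by (simp add: cinner_diff_right)

lemma bcl_bounded_linear: "bcl T \<Longrightarrow> bounded_linear T"
  and bcl_scaleC: "bcl T \<Longrightarrow> T (c *\<^sub>C x) = c *\<^sub>C T x"
  by (simp_all add: bcl_def)

lemma bclI: 
  assumes "\<And>x y. T (x + y) = T x + T y" "\<And>c x. T (c *\<^sub>C x) = c *\<^sub>C T x" "\<And>x. norm (T x) \<le> norm x * K"
  shows "bcl T"
  unfolding bcl_def using assms by (auto intro!: bounded_linear_intro[where K = K] simp: scaleR_scaleC)

lemma bcl_add: "bcl T \<Longrightarrow> T (x + y) = T x + T y"
  and bcl_diff: "bcl T \<Longrightarrow> T (x - y) = T x - T y"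
  and bcl_minus: "bcl T \<Longrightarrow> T (- x) = - T x"
  and bcl_zero: "bcl T \<Longrightarrow> T 0 = 0"
  by (simp_all add: bcl_def linear_simps)

lemmas bcl_simps = bcl_add bcl_diff bcl_minus bcl_zero bcl_scaleC

lemma bcl_ident: "bcl (\<lambda>x. x)"
  and bcl_comp: "bcl S \<Longrightarrow> bcl T \<Longrightarrow> bcl (\<lambda>x. S (T x))"
  and bcl_plus: "bcl S \<Longrightarrow> bcl T \<Longrightarrow> bcl (\<lambda>x. S x + T x)"
  and bcl_sub: "bcl S \<Longrightarrow> bcl T \<Longrightarrow> bcl (\<lambda>x. S x - T x)"
  and bcl_smult: "bcl T \<Longrightarrow> bcl (\<lambda>x. c *\<^sub>C T x)"
  by (auto simp: bcl_def scaleC_simps bounded_linear_add bounded_linear_sub mult.commute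
      intro!: bounded_linear_compose[of S T] bounded_linear_compose[OF bounded_linear_scaleC_right])

text \<open>Lax--Milgram: y minimises the functional \<open>\<parallel>T x\<parallel>\<^sup>2 - 2 Re (f x)\<close>.\<close>
lemma coercive_representation:
  fixes T :: "'a::chilbert \<Rightarrow> 'b::chilbert"
  assumes M: "csubspace M" and T: "bcl T" and c: "c > 0" "\<And>x. x \<in> M \<Longrightarrow> c * norm x \<le> norm (T x)"
    and f: "bounded_linear f" "\<And>c x. f (c *\<^sub>C x) = c * f x"
  obtains y where "y \<in> M" "\<And>h. h \<in> M \<Longrightarrow> f h = cinner (T y) (T h)"
proof -
  define J where "J x = (norm (T x))\<^sup>2 - 2 * Re (f x)" for x
  note T' = bcl_simps[OF T]
  note f' = linear_simps[OF f(1)]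
  have M_add: "x + y \<in> M" and M_scale: "a *\<^sub>C x \<in> M" if "x \<in> M" "y \<in> M" for x y a
    using M that by (auto simp: csubspace_def)
  have M_diff: "x - y \<in> M" if "x \<in> M" "y \<in> M" for x y
    using M_add[of x "(-1) *\<^sub>C y"] M_scale[of y y "-1"] that by simp
  have "0 \<in> M" "closed M" using M by (auto simp: csubspace_def)
  obtain K where K: "\<And>x. norm (f x) \<le> norm x * K" "K > 0"
    using bounded_linear.pos_bounded[OF f(1)] by blast
  \<comment> \<open>Completing the square: \<open>J x\<close> is at least
    \<open>(c * norm x - K / c)\<^sup>2 - (K / c)\<^sup>2\<close>.\<close>
  have "J x \<ge> - (K / c)\<^sup>2" if "x \<in> M" for x
  proof -
    have "Re (f x) \<le> norm x * K"
      using K(1)[of x] complex_Re_le_cmod[of "f x"] by linarith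
    moreover have "(c * norm x)\<^sup>2 \<le> (norm (T x))\<^sup>2"
      using c(2)[OF that] c(1) by (intro power_mono) auto
    moreover have "0 \<le> (c * norm x - K / c)\<^sup>2" by simp
    moreover have "2 * (c * norm x) * (K / c) = 2 * (norm x * K)" using c(1) by simp
    ultimately show ?thesis
      unfolding J_def power2_diff by linarith
  qed
  then have bdd: "bdd_below (J ` M)" by (auto intro!: bdd_belowI)
  define m where "m = Inf (J ` M)"
  have m_le: "m \<le> J x" if "x \<in> M" for x
    unfolding m_def using bdd that by (auto intro: cInf_lower)
  have "\<exists>x\<in>M. J x < m + 1 / Suc n" for n
    using cInf_lessD[of "J ` M" "m + 1 / Suc n"] \<open>0 \<in> M\<close> by (fastforce simp: m_def)
  then obtain x where xM: "\<And>n. x n \<in> M" and xJ: "\<And>n. J (x n) < m + 1 / Suc n"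
    by metis
  \<comment> \<open>The parallelogram law at the midpoint, which lies in \<open>M\<close>, bounds
    distances by the excess of \<open>J\<close> over its infimum; coercivity passes from
    \<open>T (u - v)\<close> to \<open>u - v\<close>. Minimising sequences are therefore
    Cauchy.\<close>
  have para: "c\<^sup>2 * (norm (u - v))\<^sup>2 \<le> 2 * (J u - m) + 2 * (J v - m)" if "u \<in> M" "v \<in> M" for u v
  proof -
    have "(c * norm (u - v))\<^sup>2 \<le> (norm (T (u - v)))\<^sup>2"
      using c(2)[OF M_diff[OF that]] c(1) by (intro power_mono) auto
    moreover have "m \<le> J ((1/2) *\<^sub>C (u + v))"
      using that by (intro m_le M_scale M_add) auto
    moreover have "4 * J ((1/2) *\<^sub>C (u + v)) + (norm (T (u - v)))\<^sup>2 = 2 * J u + 2 * J v"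
      using norm_add_sq[of "T u" "T v"] norm_add_sq[of "T u" "- T v"]
      by (simp add: J_def T' f' f(2) norm_scaleC power_mult_distrib power_divide field_simps)
    ultimately show ?thesis by (simp add: power_mult_distrib)
  qed
  have "Cauchy x"
  proof (rule CauchyI)
    fix e :: real assume e: "e > 0"
    define d where "d = c\<^sup>2 * e\<^sup>2"
    have "d > 0" using c(1) e by (simp add: d_def)
    then obtain N where N: "1 / Suc N < d / 4"
      using nat_approx_posE[of "d / 4"] by auto
    have "norm (x i - x j) < e" if "i \<ge> N" "j \<ge> N" for i j
    proof -
      have "1 / real (Suc i) \<le> 1 / real (Suc N)" "1 / real (Suc j) \<le> 1 / real (Suc N)"
        using that by (auto simp: frac_le)
      then have "J (x i) - m < d / 4" "J (x j) - m < d / 4"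
        using xJ[of i] xJ[of j] N by linarith+
      then have "2 * (J (x i) - m) + 2 * (J (x j) - m) < d" by simp
      then have "c\<^sup>2 * (norm (x i - x j))\<^sup>2 < d"
        using para[OF xM xM, of i j] by (rule order_le_less_trans[rotated])
      then have "(norm (x i - x j))\<^sup>2 < e\<^sup>2"
        unfolding d_def by (rule mult_left_less_imp_less) simp
      then show ?thesis by (rule power2_less_imp_less) (use e in simp)
    qed
    then show "\<exists>N. \<forall>i\<ge>N. \<forall>j\<ge>N. norm (x i - x j) < e" by blast
  qed
  then obtain y where y: "x \<longlonglongrightarrow> y" using Cauchy_convergent_iff convergent_def by metis
  have yM: "y \<in> M" using \<open>closed M\<close> xM y closed_sequentially by blast
  have "(\<lambda>n. J (x n)) \<longlonglongrightarrow> J y"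
    unfolding J_def
    by (intro tendsto_intros bounded_linear.tendsto[OF f(1)] bounded_linear.tendsto[OF bcl_bounded_linear[OF T]] y)
  moreover have "(\<lambda>n. J (x n)) \<longlonglongrightarrow> m"
  proof (rule tendsto_sandwich[of "\<lambda>_. m" _ _ "\<lambda>n. m + 1 / Suc n"])
    show "(\<lambda>n. m + 1 / Suc n) \<longlonglongrightarrow> m"
      using tendsto_add[OF tendsto_const[of m] LIMSEQ_inverse_real_of_nat] by (simp add: inverse_eq_divide)
    show "\<forall>\<^sub>F n in sequentially. J (x n) \<le> m + 1 / Suc n"
      using xJ by (intro always_eventually allI less_imp_le)
  qed (simp_all add: xM m_le)
  ultimately have Jy: "J y = m" using LIMSEQ_unique by blast
  have var: "Re (f h) = Re (cinner (T y) (T h))" if h: "h \<in> M" for h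
  proof -
    define d where "d = Re (cinner (T y) (T h)) - Re (f h)"
    define q where "q = (norm (T h))\<^sup>2"
    have "0 \<le> t\<^sup>2 * q + 2 * t * d" for t :: real
    proof -
      have "J y \<le> J (y + complex_of_real t *\<^sub>C h)"
        unfolding Jy using yM h by (intro m_le M_add M_scale) auto
      also have "\<dots> = J y + t\<^sup>2 * q + 2 * t * d"
        by (simp add: J_def T' f' f(2) norm_add_sq norm_scaleC cinner_simps d_def q_def power_mult_distrib algebra_simps)
      finally show ?thesis by simp
    qed
    note pos = this
    have q: "q \<ge> 0" by (simp add: q_def)
    \<comment> \<open>Close to the minimiser \<open>- d / q\<close> of the quadratic in
      \<open>t\<close>; the added 1 covers \<open>q = 0\<close>.\<close>
    define t where "t = - d / (q + 1)"
    have t: "t * (q + 1) = - d" using q by (simp add: t_def)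
    have "0 \<le> (q + 1)\<^sup>2 * (t\<^sup>2 * q + 2 * t * d)"
      by (intro mult_nonneg_nonneg pos) simp
    also have "\<dots> = (t * (q + 1))\<^sup>2 * q + 2 * (t * (q + 1)) * (q + 1) * d"
      by (simp add: power2_eq_square algebra_simps)
    also have "\<dots> = - (d\<^sup>2 * (q + 2))"
      unfolding t by (simp add: power2_eq_square algebra_simps)
    finally have "d\<^sup>2 * (q + 2) \<le> 0" by simp
    then have "d = 0"
      using q by (simp add: mult_le_0_iff)
    then show ?thesis by (simp add: d_def)
  qed
  \<comment> \<open>Minimality yields real parts only; testing with \<open>\<i> h\<close> supplies
    the imaginary part.\<close>
  have "f h = cinner (T y) (T h)" if h: "h \<in> M" for h
    using var[OF h] var[OF M_scale[OF h h, of \<i>]] f(2)[of \<i> h]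
    by (simp add: T' cinner_simps complex_eq_iff)
  then show thesis using that yM by blast
qed

text \<open>\<open>adj\<close> is a choice, so its defining equation needs a witness: the Riesz
  representation of \<open>\<lambda>x. cinner y (T x)\<close>, which is
  \<open>coercive_representation\<close> for the identity on the whole space with constant
  1.\<close>

lemma adj_cinner:
  assumes "bcl T"
  shows "cinner (T x) y = cinner x (adj T y)"
proof -
  have "\<exists>z. \<forall>x. cinner (T x) y = cinner x z" for y
  proof -
    have "csubspace (UNIV :: 'a set)" by (simp add: csubspace_def)
    moreover have "bounded_linear (\<lambda>x. cinner y (T x))"
      using bounded_linear_compose[OF bounded_linear_cinner_right bcl_bounded_linear[OF assms]] .
    ultimately obtain z where "\<And>h. cinner y (T h) = cinner z h"
      using coercive_representation[of UNIV "\<lambda>x. x" 1 "\<lambda>x. cinner y (T x)"] assms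
      by (auto simp: bcl_ident bcl_scaleC cinner_simps)
    then have "cinner (T x) y = cinner x z" for x
      by (metis cinner_commute)
    then show ?thesis by blast
  qed
  then have "\<exists>S. \<forall>x y. cinner (T x) y = cinner x (S y)" by metis
  then show ?thesis unfolding adj_def by (rule someI2_ex) auto
qed

text \<open>Polarization: the norm of a sum determines the real part, and replacing \<open>y\<close>
  by \<open>\<i> y\<close> gives the imaginary part.\<close>

lemma isometry_cinner:
  assumes "isometry V"
  shows "cinner (V x) (V y) = cinner x y"
proof -
  have V: "bcl V" "\<And>x. norm (V x) = norm x" using assms by (auto simp: isometry_def)
  have Re: "Re (cinner (V x) (V y)) = Re (cinner x y)" for x y
    using norm_add_sq[of "V x" "V y"] norm_add_sq[of x y] V(2)[of "x + y"]
    by (simp add: bcl_simps[OF V(1)] V(2))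
  show ?thesis using Re[of x y] Re[of x "\<i> *\<^sub>C y"]
    by (simp add: bcl_simps[OF V(1)] cinner_simps complex_eq_iff)
qed

lemma isometry_adj: "isometry V \<Longrightarrow> adj V (V x) = x"
  by (rule cinner_eqI) (metis isometry_cinner adj_cinner isometry_def)

lemma isometry_bcl: "isometry V \<Longrightarrow> bcl V"
  by (simp add: isometry_def)

lemma unitary_adj: "unitary U \<Longrightarrow> U (adj U x) = x"
  unfolding unitary_def by (metis isometry_adj surjD)

lemma bcl_adj:
  assumes "isometry U"
  shows "bcl (adj U)"
proof (rule bclI)
  have [simp]: "cinner x (adj U y) = cinner (U x) y" for x y
    using adj_cinner assms isometry_def by metis
  show "adj U (x + y) = adj U x + adj U y" for x y
    by (rule cinner_eqI) (simp add: cinner_add_right)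
  show "adj U (c *\<^sub>C x) = c *\<^sub>C adj U x" for c x
    by (rule cinner_eqI) (simp add: cinner_scaleC_right)
  show "norm (adj U x) \<le> norm x * 1" for x
  proof -
    have "(norm (adj U x))\<^sup>2 = Re (cinner (U (adj U x)) x)"
      by (simp add: norm_sq_cinner)
    also have "\<dots> \<le> norm (U (adj U x)) * norm x"
      using norm_cinner_le complex_Re_le_cmod order_trans by blast
    also have "\<dots> = norm (adj U x) * norm x"
      using assms by (simp add: isometry_def)
    finally have "norm (adj U x) * norm (adj U x) \<le> norm (adj U x) * norm x"
      by (simp add: power2_eq_square)
    then show ?thesis
      by (cases "adj U x = 0") (simp_all add: mult_le_cancel_left)
  qed
qed

subsection \<open>Unitary operators reduced by a projection\<close>

text \<open>Uniform boundedness for a sequence of functionals: the sets \<open>A k\<close> are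
  closed and exhaust the space, so by Baire one of them contains a ball.\<close>

lemma weakly_bounded_imp_bounded:
  fixes y :: "nat \<Rightarrow> 'e::chilbert"
  assumes "\<And>x. \<exists>C. \<forall>n. cmod (cinner (y n) x) \<le> C"
  obtains K where "\<And>n. norm (y n) \<le> K"
proof -
  define A where "A k = {x. \<forall>n. cmod (cinner (y n) x) \<le> real k}" for k :: nat
  have "A k = (\<Inter>n. {x. cmod (cinner (y n) x) \<le> real k})" for k
    by (auto simp: A_def)
  moreover have "closed {x. cmod (cinner (y n) x) \<le> real k}" for n k
    by (intro closed_Collect_le continuous_intros
        linear_continuous_on[OF bounded_linear_cinner_right])
  ultimately have closed: "closed (A k)" for k by auto
  have "x \<in> (\<Union>k. A k)" for x
  proof -
    obtain C where "\<And>n. cmod (cinner (y n) x) \<le> C" using assms by blast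
    then have "x \<in> A (nat \<lceil>C\<rceil>)"
      unfolding A_def by (smt (verit) mem_Collect_eq of_nat_ceiling)
    then show ?thesis by blast
  qed
  then have UN: "(\<Union>k. A k) = UNIV" by blast
  have "\<exists>k. interior (A k) \<noteq> {}"
  proof (rule ccontr)
    assume "\<not> ?thesis"
    then have "euclidean interior_of \<Union>(range A) = {}"
      using closed
      by (intro Baire_category_alt disjI1 completely_metrizable_space_euclidean) auto
    then show False using UN by simp
  qed
  then obtain k x0 where "x0 \<in> interior (A k)" by blast
  then obtain r where r: "r > 0" "cball x0 r \<subseteq> A k"
    using mem_interior_cball by metis
  have "norm (y n) \<le> 2 * real k / r" for n
  proof (cases "y n = 0")
    case False
    \<comment> \<open>The vector of length \<open>r\<close> along \<open>y n\<close> makes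
      \<open>cinner (y n) v\<close> equal to \<open>r * norm (y n)\<close>; since \<open>x0\<close>
      and \<open>x0 + v\<close> both lie in \<open>A k\<close>, this is at most
      \<open>2 * k\<close>.\<close>
    define v where "v = complex_of_real (r / norm (y n)) *\<^sub>C y n"
    have "norm v = r" using r False by (simp add: v_def norm_scaleC norm_divide)
    then have "x0 + v \<in> A k" "x0 \<in> A k"
      using r by (auto intro!: subsetD[OF r(2)] simp: dist_norm)
    then have "cmod (cinner (y n) (x0 + v)) \<le> k" "cmod (cinner (y n) x0) \<le> k"
      by (auto simp: A_def)
    then have "cmod (cinner (y n) v) \<le> 2 * real k"
      using norm_triangle_ineq4[of "cinner (y n) (x0 + v)" "cinner (y n) x0"]
      by (simp add: cinner_simps)
    also have "cinner (y n) v = complex_of_real (r * norm (y n))"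
      using False by (simp add: v_def cinner_simps cinner_self power2_eq_square)
    finally show ?thesis using r by (simp add: field_simps norm_mult)
  qed (use r in simp)
  then show thesis using that by blast
qed

text \<open>\<open>V'\<close> is a parameter of its own instead of \<open>adj V\<close>, so that
  exchanging \<open>V\<close> and \<open>V'\<close> gives another instance. The two uses are
  \<open>(P, U, adj U)\<close> and \<open>(I - P, adj U, U)\<close>, so all estimates are made
  once.\<close>

locale reduced_unitary =
  fixes Q V V' :: "'e::chilbert \<Rightarrow> 'e"
  assumes Q: "orth_proj Q" and V: "bcl V" and V': "bcl V'"
    and VV' [simp]: "V (V' x) = x" and V'V [simp]: "V' (V x) = x"
    and V_cinner: "cinner (V x) y = cinner x (V' y)"
    and QV: "Q (V x) = V (Q x)"
begin

lemma bcl_Q: "bcl Q" and QQ [simp]: "Q (Q x) = Q x" and Q_cinner: "cinner (Q x) y = cinner x (Q y)"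
  using Q by (auto simp: orth_proj_def)

lemmas lin = bcl_simps[OF V] bcl_simps[OF V'] bcl_simps[OF bcl_Q]

lemma range_Q_iff: "x \<in> range Q \<longleftrightarrow> Q x = x"
  by (metis QQ rangeE rangeI)

lemma QV': "Q (V' x) = V' (Q x)"
  by (metis QV VV' V'V)

lemma V'_cinner: "cinner (V' x) y = cinner x (V y)"
proof -
  have "cinner (V' x) y = cnj (cinner y (V' x))" by (rule cinner_commute)
  also have "\<dots> = cnj (cinner (V y) x)" by (simp add: V_cinner)
  also have "\<dots> = cinner x (V y)" by (rule cinner_commute[symmetric])
  finally show ?thesis .
qed

lemma dual: "reduced_unitary Q V' V"
  by unfold_locales (simp_all add: Q V V' QV' V'_cinner)

lemma norm_V: "norm (V x) = norm x"
  by (simp add: norm_cinner V_cinner)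

lemma norm_V': "norm (V' x) = norm x"
  using reduced_unitary.norm_V[OF dual] .

lemma csubspace_range_Q: "csubspace (range Q)"
proof -
  have "range Q = (\<lambda>x. Q x - x) -` {0}"
    by (auto simp: range_Q_iff)
  moreover have "continuous_on UNIV (\<lambda>x. Q x - x)"
    by (intro continuous_intros linear_continuous_on bcl_bounded_linear bcl_Q)
  ultimately have "closed (range Q)"
    by (simp add: continuous_closed_vimage continuous_on_eq_continuous_at)
  then show ?thesis
    by (auto simp: csubspace_def range_Q_iff lin)
qed

text \<open>By normality \<open>N = aV + b\<close> commutes with its adjoint \<open>N'\<close>, so a solution of \<open>N' N y = e\<close>
  gives the preimage \<open>N' y\<close> of \<open>e\<close>.\<close>
lemma bounded_below_imp_bij:
  assumes c: "c > 0" and bb: "\<And>x. x \<in> range Q \<Longrightarrow> c * norm x \<le> norm (a *\<^sub>C V x + b *\<^sub>C x)"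
  shows "bij_betw (\<lambda>x. a *\<^sub>C V x + b *\<^sub>C x) (range Q) (range Q)"
proof -
  define N where "N x = a *\<^sub>C V x + b *\<^sub>C x" for x
  define N' where "N' x = cnj a *\<^sub>C V' x + cnj b *\<^sub>C x" for x
  have N: "bcl N" unfolding N_def by (intro bcl_plus bcl_smult V bcl_ident)
  have N_N': "cinner (N x) y = cinner x (N' y)" for x y
    by (simp add: N_def N'_def cinner_simps V_cinner)
  have comm: "N (N' x) = N' (N x)" for x
    by (simp add: N_def N'_def lin scaleC_simps mult.commute add_ac)
  have Q_N: "Q (N x) = N (Q x)" "Q (N' x) = N' (Q x)" for x
    by (simp_all add: N_def N'_def lin QV QV')
  have "inj_on N (range Q)"
  proof (rule inj_onI)
    fix x y assume xy: "x \<in> range Q" "y \<in> range Q" "N x = N y"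
    then have "x - y \<in> range Q" by (simp add: range_Q_iff lin)
    then have "c * norm (x - y) \<le> norm (N (x - y))" using bb by (simp add: N_def)
    also have "\<dots> = 0" using xy by (simp add: bcl_simps[OF N])
    finally show "x = y" using c by (simp add: mult_le_0_iff)
  qed
  moreover have "N ` range Q = range Q"
  proof
    show "N ` range Q \<subseteq> range Q" by (auto simp: Q_N[symmetric])
    show "range Q \<subseteq> N ` range Q"
    proof
      fix e assume e: "e \<in> range Q"
      obtain y where y: "y \<in> range Q" and rep: "\<And>h. h \<in> range Q \<Longrightarrow> cinner e h = cinner (N y) (N h)"
        using coercive_representation[OF csubspace_range_Q N c, of "cinner e"] bb
        by (auto simp: N_def bounded_linear_cinner_right cinner_simps)
      \<comment> \<open>\<open>rep\<close> tests only against \<open>range Q\<close>;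
        \<open>Q e = e\<close> and the commutation of \<open>Q\<close> with \<open>N\<close> and
        \<open>N'\<close> extend it to every \<open>h\<close>.\<close>
      have "cinner h (N (N' y)) = cinner h e" for h
      proof -
        have "cinner h e = cinner (Q h) e" using e by (simp add: Q_cinner range_Q_iff)
        also have "\<dots> = cinner (N (Q h)) (N y)"
          using rep[of "Q h"] by (metis cinner_commute rangeI)
        also have "\<dots> = cinner h (N (N' y))"
          using y by (simp add: N_N' Q_cinner Q_N comm range_Q_iff)
        finally show ?thesis by simp
      qed
      then have "N (N' y) = e" by (rule cinner_eqI)
      moreover have "N' y \<in> range Q" using y by (simp add: range_Q_iff Q_N)
      ultimately show "e \<in> N ` range Q" by blast
    qed
  qed
  ultimately show ?thesis by (simp add: bij_betw_def N_def[abs_def])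
qed

text \<open>\<open>V - l\<close> is normal, so its adjoint has the same norm at \<open>x\<close>;
  Cauchy-Schwarz does the rest. An approximate eigenvector is thus nearly orthogonal to vectors in
  the range of \<open>V - l\<close>, with control by the norm of a preimage.\<close>

lemma cinner_V_minus:
  "cmod (cinner x (V y - l *\<^sub>C y)) \<le> norm (V x - l *\<^sub>C x) * norm y"
proof -
  have "norm (V' x - cnj l *\<^sub>C x) = norm (V x - l *\<^sub>C x)"
  proof -
    have "(norm (V' x - cnj l *\<^sub>C x))\<^sup>2 = (norm (V x - l *\<^sub>C x))\<^sup>2"
      using norm_add_sq[of "V' x" "- (cnj l *\<^sub>C x)"] norm_add_sq[of "V x" "- (l *\<^sub>C x)"]
        V_cinner[of x x] cinner_commute[of "V' x" x]
      by (simp add: norm_V norm_V' norm_scaleC cinner_simps)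
    then show ?thesis by (simp add: power2_eq_iff_nonneg)
  qed
  moreover have "cinner x (V y - l *\<^sub>C y) = cinner (V' x - cnj l *\<^sub>C x) y"
    by (simp add: cinner_simps V'_cinner)
  ultimately show ?thesis using norm_cinner_le by metis
qed

abbreviation "\<sigma> \<equiv> spec_on (range Q) V"

text \<open>The spectrum of a unitary is its approximate point spectrum. A lower bound gives
  bijectivity by normality. Conversely, without a lower bound there are approximate eigenvectors,
  and surjectivity would make multiples of them with norms tending to infinity weakly
  bounded.\<close>

lemma not_in_spec_iff:
  "l \<notin> \<sigma> \<longleftrightarrow> (\<exists>c>0. \<forall>x\<in>range Q. c * norm x \<le> norm (V x - l *\<^sub>C x))"
proof
  assume "\<exists>c>0. \<forall>x\<in>range Q. c * norm x \<le> norm (V x - l *\<^sub>C x)"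
  then show "l \<notin> \<sigma>"
    using bounded_below_imp_bij[of _ 1 "- l"] by (auto simp: spec_on_def)
next
  assume l: "l \<notin> \<sigma>"
  show "\<exists>c>0. \<forall>x\<in>range Q. c * norm x \<le> norm (V x - l *\<^sub>C x)"
  proof (rule ccontr)
    assume "\<not> ?thesis"
    then have "\<exists>x\<in>range Q. norm (V x - l *\<^sub>C x) < 1 / Suc n * norm x" for n
      by (metis not_le of_nat_0_less_iff zero_less_Suc zero_less_divide_1_iff)
    then obtain x where x: "\<And>n. x n \<in> range Q"
      "\<And>n. norm (V (x n) - l *\<^sub>C x n) < 1 / Suc n * norm (x n)" by metis
    then have nz: "norm (x n) > 0" for n
      by (metis mult_zero_right norm_ge_zero not_less order_le_less zero_less_norm_iff norm_zero)
    \<comment> \<open>Rescaled so that \<open>norm (y n) = Suc n\<close>, exactly the rate that the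
      factor \<open>1 / Suc n\<close> in the choice of \<open>x n\<close> absorbs.\<close>
    define y where "y n = complex_of_real (Suc n / norm (x n)) *\<^sub>C x n" for n
    have "\<exists>C. \<forall>n. cmod (cinner (y n) e) \<le> C" for e
    proof -
      have "Q e \<in> (\<lambda>x. V x - l *\<^sub>C x) ` range Q"
        using l by (auto simp: spec_on_def bij_betw_def)
      then obtain k where k: "Q e = V k - l *\<^sub>C k" by blast
      have "cmod (cinner (y n) e) \<le> norm k" for n
      proof -
        have "cinner (x n) e = cinner (x n) (Q e)"
          using x(1)[of n] by (metis Q_cinner range_Q_iff)
        then have "cmod (cinner (x n) e) \<le> 1 / Suc n * norm (x n) * norm k"
          using order_trans[OF cinner_V_minus[of "x n" k l]
              mult_right_mono[OF less_imp_le[OF x(2)[of n]]]] k by simp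
        then show ?thesis using nz[of n]
          by (simp add: y_def cinner_simps norm_mult norm_divide field_simps
              del: of_nat_Suc of_real_of_nat_eq)
      qed
      then show ?thesis by blast
    qed
    then obtain K where K: "\<And>n. norm (y n) \<le> K"
      using weakly_bounded_imp_bounded by blast
    have Suc_le: "real (Suc n) \<le> K" for n
      using K[of n] nz[of n] by (simp add: y_def norm_scaleC norm_divide norm_mult del: of_nat_Suc)
    obtain n where "K < real n" using reals_Archimedean2 by blast
    moreover have "real n + 1 \<le> K" using Suc_le[of n] by simp
    ultimately show False by linarith
  qed
qed

text \<open>A lower bound \<open>c\<close> for \<open>V - l\<close> leaves the lower bound
  \<open>c - dist l m\<close> for \<open>V - m\<close>, so the complement is open.\<close>

lemma closed_spec: "closed \<sigma>"
proof -
  have "open (- \<sigma>)"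
  proof (rule openI)
    fix l assume "l \<in> - \<sigma>"
    then obtain c where c: "c > 0" "\<And>x. x \<in> range Q \<Longrightarrow> c * norm x \<le> norm (V x - l *\<^sub>C x)"
      using not_in_spec_iff by auto
    have "m \<notin> \<sigma>" if m: "dist l m < c" for m
    proof -
      have "(c - dist l m) * norm x \<le> norm (V x - m *\<^sub>C x)" if "x \<in> range Q" for x
        using c(2)[OF that] norm_triangle_ineq[of "V x - m *\<^sub>C x" "(m - l) *\<^sub>C x"]
        unfolding norm_scaleC by (simp add: left_diff_distrib scaleC_diff_left dist_norm norm_minus_commute)
      moreover have "c - dist l m > 0" using m by simp
      ultimately show ?thesis unfolding not_in_spec_iff by blast
    qed
    then show "\<exists>e>0. ball l e \<subseteq> - \<sigma>" using c(1) by (auto intro!: exI[of _ c])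
  qed
  then show ?thesis by (simp add: closed_def)
qed

lemma norm_spec:
  assumes "l \<in> \<sigma>"
  shows "cmod l = 1"
proof (rule ccontr)
  assume "cmod l \<noteq> 1"
  moreover have "\<bar>1 - cmod l\<bar> * norm x \<le> norm (V x - l *\<^sub>C x)" for x
  proof -
    have "\<bar>1 - cmod l\<bar> * norm x = \<bar>(1 - cmod l) * norm x\<bar>" by (simp add: abs_mult)
    then show ?thesis
      using norm_triangle_ineq3[of "V x" "l *\<^sub>C x"]
      by (simp add: norm_V norm_scaleC left_diff_distrib)
  qed
  ultimately have "\<exists>c>0. \<forall>x\<in>range Q. c * norm x \<le> norm (V x - l *\<^sub>C x)"
    by (intro exI[of _ "\<bar>1 - cmod l\<bar>"]) auto
  then show False using assms not_in_spec_iff[of l] by blast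
qed

text \<open>For the normal operator \<open>V - l\<close> surjectivity forces injectivity: a kernel
  vector \<open>u = (V - l) k\<close> is orthogonal to the range by \<open>cinner_V_minus\<close>,
  hence to itself. So a spectral value is visible in the range alone, which is what stage 3
  records.\<close>

lemma spec_not_surj:
  assumes "l \<in> \<sigma>"
  shows "\<exists>e\<in>range Q. \<forall>x\<in>range Q. V x - l *\<^sub>C x \<noteq> e"
proof (rule ccontr)
  assume contra: "\<not> ?thesis"
  have surj: "\<exists>x\<in>range Q. V x - l *\<^sub>C x = e" if "e \<in> range Q" for e
    using contra that by blast
  have "inj_on (\<lambda>x. V x - l *\<^sub>C x) (range Q)"
  proof (rule inj_onI)
    fix x y assume xy: "x \<in> range Q" "y \<in> range Q" "V x - l *\<^sub>C x = V y - l *\<^sub>C y"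
    define u where "u = x - y"
    have u: "u \<in> range Q" "V u - l *\<^sub>C u = 0"
      using xy by (auto simp: u_def range_Q_iff lin scaleC_diff_right algebra_simps)
    obtain k where "V k - l *\<^sub>C k = u" using surj u by blast
    then have "cinner u u = 0"
      using cinner_V_minus[of u k l] u by simp
    then show "x = y" by (simp add: cinner_eq_zero_iff u_def)
  qed
  moreover have "(\<lambda>x. V x - l *\<^sub>C x) ` range Q = range Q"
  proof
    show "(\<lambda>x. V x - l *\<^sub>C x) ` range Q \<subseteq> range Q"
    proof (rule image_subsetI)
      fix x assume "x \<in> range Q"
      then have "Q x = x" by (simp only: range_Q_iff)
      then have "Q (V x - l *\<^sub>C x) = V x - l *\<^sub>C x"
        by (simp only: bcl_simps[OF bcl_Q] QV)
      then show "V x - l *\<^sub>C x \<in> range Q" by (simp only: range_Q_iff)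
    qed
    show "range Q \<subseteq> (\<lambda>x. V x - l *\<^sub>C x) ` range Q"
    proof
      fix e assume "e \<in> range Q"
      from surj[OF this] obtain x where x: "x \<in> range Q" "V x - l *\<^sub>C x = e" by (rule bexE)
      show "e \<in> (\<lambda>x. V x - l *\<^sub>C x) ` range Q"
        unfolding x(2)[symmetric] using x(1) by (rule imageI)
    qed
  qed
  ultimately show False using assms by (simp add: spec_on_def bij_betw_def)
qed

end

subsection \<open>Koszul complexes and the Hardy space\<close>

text \<open>\<open>A\<close> and \<open>B\<close> form a contracting homotopy: a cycle
  \<open>(h1, h2)\<close> is the image of \<open>A h1 + B h2\<close>, and \<open>f\<close> is the
  image of \<open>(- B f, A f)\<close>. They only have to preserve \<open>X\<close>, commute with
  \<open>T1\<close> and \<open>T2\<close> and split the identity, so multiplication by fibrewise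
  inverses qualifies.\<close>

lemma koszul_exactI:
  fixes T1 T2 A B :: "'v::ab_group_add \<Rightarrow> 'v"
  assumes X: "\<And>x y. x \<in> X \<Longrightarrow> y \<in> X \<Longrightarrow> x + y \<in> X" "\<And>x. x \<in> X \<Longrightarrow> - x \<in> X"
    and maps: "\<And>x. x \<in> X \<Longrightarrow> T1 x \<in> X" "\<And>x. x \<in> X \<Longrightarrow> T2 x \<in> X"
      "\<And>x. x \<in> X \<Longrightarrow> A x \<in> X" "\<And>x. x \<in> X \<Longrightarrow> B x \<in> X"
    and add: "\<And>x y. x \<in> X \<Longrightarrow> y \<in> X \<Longrightarrow> T1 (x + y) = T1 x + T1 y"
      "\<And>x y. x \<in> X \<Longrightarrow> y \<in> X \<Longrightarrow> T2 (x + y) = T2 x + T2 y"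
    and minus: "\<And>x. x \<in> X \<Longrightarrow> T2 (- x) = - T2 x"
    and comm: "\<And>x. x \<in> X \<Longrightarrow> T1 (T2 x) = T2 (T1 x)"
      "\<And>x. x \<in> X \<Longrightarrow> A (T1 x) = T1 (A x)" "\<And>x. x \<in> X \<Longrightarrow> A (T2 x) = T2 (A x)"
      "\<And>x. x \<in> X \<Longrightarrow> B (T1 x) = T1 (B x)" "\<And>x. x \<in> X \<Longrightarrow> B (T2 x) = T2 (B x)"
    and split: "\<And>x. x \<in> X \<Longrightarrow> A (T1 x) + B (T2 x) = x"
  shows "koszul_exact_on X T1 T2"
  unfolding koszul_exact_on_def
proof (intro conjI)
  show "inj_on (\<lambda>h. (T1 h, T2 h)) X"
    by (rule inj_onI) (metis split prod.inject)
  show "{(h1, h2). h1 \<in> X \<and> h2 \<in> X \<and> T1 h2 - T2 h1 = 0} = (\<lambda>h. (T1 h, T2 h)) ` X"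
  proof (intro equalityI subsetI)
    fix p assume "p \<in> {(h1, h2). h1 \<in> X \<and> h2 \<in> X \<and> T1 h2 - T2 h1 = 0}"
    then obtain h1 h2 where p: "p = (h1, h2)" and h: "h1 \<in> X" "h2 \<in> X" "T1 h2 = T2 h1" by auto
    define k where "k = A h1 + B h2"
    have kX: "k \<in> X" using h by (simp add: k_def X maps)
    have "T1 k = A (T1 h1) + B (T1 h2)"
      using h by (simp add: k_def add maps comm(2-5)[symmetric])
    then have "T1 k = h1" using h split by simp
    moreover have "T2 k = A (T2 h1) + B (T2 h2)"
      using h by (simp add: k_def add maps comm(2-5)[symmetric])
    then have "T2 k = h2" using h split[of h2] by simp
    ultimately show "p \<in> (\<lambda>h. (T1 h, T2 h)) ` X"
      using kX p by auto
  qed (auto simp: comm maps)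
  show "(\<lambda>(h1, h2). T1 h2 - T2 h1) ` (X \<times> X) = X"
  proof (intro equalityI subsetI)
    fix f assume "f \<in> (\<lambda>(h1, h2). T1 h2 - T2 h1) ` (X \<times> X)"
    then show "f \<in> X" using X maps by (auto simp: diff_conv_add_uminus simp del: add_uminus_conv_diff)
  next
    fix f assume f: "f \<in> X"
    have "f = T1 (A f) - T2 (- B f)"
      using split[OF f] f by (simp add: minus maps comm)
    then show "f \<in> (\<lambda>(h1, h2). T1 h2 - T2 h1) ` (X \<times> X)"
      using f X maps by (intro image_eqI[of _ _ "(- B f, A f)"]) auto
  qed
qed

lemma koszul_exact_imp_not_breaks:
  fixes T1 T2 :: "'v::ab_group_add \<Rightarrow> 'v"
  assumes "koszul_exact_on X T1 T2" and X: "\<And>x. x \<in> X \<Longrightarrow> - x \<in> X"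
    and minus: "\<And>x. x \<in> X \<Longrightarrow> T2 (- x) = - T2 x"
  shows "\<not> koszul_breaks_stage3_on X T1 T2"
proof -
  have "{T1 a + T2 b | a b. a \<in> X \<and> b \<in> X} = (\<lambda>(h1, h2). T1 h2 - T2 h1) ` (X \<times> X)"
  proof (intro equalityI subsetI)
    fix x assume "x \<in> {T1 a + T2 b | a b. a \<in> X \<and> b \<in> X}"
    then obtain a b where "x = T1 a + T2 b" "a \<in> X" "b \<in> X" by blast
    then show "x \<in> (\<lambda>(h1, h2). T1 h2 - T2 h1) ` (X \<times> X)"
      using X minus by (intro image_eqI[of _ _ "(- b, a)"]) auto
  next
    fix x assume "x \<in> (\<lambda>(h1, h2). T1 h2 - T2 h1) ` (X \<times> X)"
    then obtain a b where "x = T1 a - T2 b" "a \<in> X" "b \<in> X" by auto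
    then have "x = T1 a + T2 (- b)" "a \<in> X" "- b \<in> X" using X minus by auto
    then show "x \<in> {T1 a + T2 b | a b. a \<in> X \<and> b \<in> X}" by blast
  qed
  then show ?thesis
    using assms(1) by (simp add: koszul_exact_on_def koszul_breaks_stage3_on_def)
qed

lemma koszul_exact_on_cong:
  assumes "\<And>x. x \<in> X \<Longrightarrow> T1 x = S1 x" "\<And>x. x \<in> X \<Longrightarrow> T2 x = S2 x"
  shows "koszul_exact_on X T1 T2 = koszul_exact_on X S1 S2"
proof -
  have "inj_on (\<lambda>h. (T1 h, T2 h)) X = inj_on (\<lambda>h. (S1 h, S2 h)) X"
    using assms by (intro inj_on_cong) auto
  moreover have "(\<lambda>h. (T1 h, T2 h)) ` X = (\<lambda>h. (S1 h, S2 h)) ` X"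
    using assms by (intro image_cong) auto
  moreover have "(\<lambda>(h1, h2). T1 h2 - T2 h1) ` (X \<times> X) = (\<lambda>(h1, h2). S1 h2 - S2 h1) ` (X \<times> X)"
    using assms by (intro image_cong) auto
  moreover have "{(h1, h2). h1 \<in> X \<and> h2 \<in> X \<and> T1 h2 - T2 h1 = 0} =
      {(h1, h2). h1 \<in> X \<and> h2 \<in> X \<and> S1 h2 - S2 h1 = 0}"
    using assms by auto
  ultimately show ?thesis by (simp add: koszul_exact_on_def)
qed

section \<open>Vector-valued Hardy space: power series, growth and coefficients\<close>

lemma hardy_summable:
  assumes "summable (\<lambda>n. (norm (a n))\<^sup>2)" "z \<in> ball 0 1"
  shows "summable (\<lambda>n. norm (z ^ n *\<^sub>C (a n :: 'e::chilbert)))"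
proof (rule summable_comparison_test')
  have "(cmod z)\<^sup>2 < 1" using assms(2) by (simp add: power_less_one_iff abs_square_less_1)
  then show "summable (\<lambda>n. ((cmod z)\<^sup>2) ^ n + (norm (a n))\<^sup>2)"
    using assms by (intro summable_add summable_geometric) auto
  fix n :: nat
  have "0 \<le> (cmod z ^ n - norm (a n))\<^sup>2" by simp
  moreover have "0 \<le> cmod z ^ n * norm (a n)" by simp
  ultimately have "cmod z ^ n * norm (a n) \<le> (cmod z ^ n)\<^sup>2 + (norm (a n))\<^sup>2"
    unfolding power2_diff by linarith
  then show "norm (norm (z ^ n *\<^sub>C a n)) \<le> ((cmod z)\<^sup>2) ^ n + (norm (a n))\<^sup>2"
    by (simp add: norm_scaleC norm_power power_mult[symmetric] mult.commute)
qed

lemma hardy2I: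
  assumes "summable (\<lambda>n. (norm (a n))\<^sup>2)" "\<And>z. z \<in> ball 0 1 \<Longrightarrow> (\<lambda>n. z ^ n *\<^sub>C a n) sums f z"
    and "\<And>z. z \<notin> ball 0 1 \<Longrightarrow> f z = 0"
  shows "f \<in> hardy2"
  using assms sums_unique unfolding hardy2_def hardy_coeffs_def by blast

lemma hardy_coeffs_sums:
  assumes "hardy_coeffs f a" "z \<in> ball 0 1"
  shows "(\<lambda>n. z ^ n *\<^sub>C a n) sums f z"
  using assms summable_norm_cancel[OF hardy_summable[of a z]]
  by (auto simp: hardy_coeffs_def summable_sums)

lemma hardy2E:
  assumes "f \<in> hardy2"
  obtains a where "summable (\<lambda>n. (norm (a n))\<^sup>2)" "\<And>z. z \<in> ball 0 1 \<Longrightarrow> (\<lambda>n. z ^ n *\<^sub>C a n) sums f z"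
proof -
  obtain a where a: "hardy_coeffs f a" using assms unfolding hardy2_def by blast
  then have "summable (\<lambda>n. (norm (a n))\<^sup>2)" by (simp add: hardy_coeffs_def)
  then show thesis using that hardy_coeffs_sums[OF a] by blast
qed

lemma hardy2_outside: "f \<in> hardy2 \<Longrightarrow> z \<notin> ball 0 1 \<Longrightarrow> f z = 0"
  unfolding hardy2_def hardy_coeffs_def by blast

lemma summable_norm_sq_add:
  assumes "summable (\<lambda>n. (norm (a n))\<^sup>2)" "summable (\<lambda>n. (norm (b n :: 'a::real_normed_vector))\<^sup>2)"
  shows "summable (\<lambda>n. (norm (a n + b n))\<^sup>2)"
proof (rule summable_comparison_test')
  show "summable (\<lambda>n. 2 * (norm (a n))\<^sup>2 + 2 * (norm (b n))\<^sup>2)"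
    using assms by (intro summable_add summable_mult)
  fix n :: nat
  have "(norm (a n + b n))\<^sup>2 \<le> (norm (a n) + norm (b n))\<^sup>2"
    by (intro power_mono norm_triangle_ineq) simp
  moreover have "0 \<le> (norm (a n) - norm (b n))\<^sup>2" by simp
  ultimately show "norm ((norm (a n + b n))\<^sup>2) \<le> 2 * (norm (a n))\<^sup>2 + 2 * (norm (b n))\<^sup>2"
    by (simp add: power2_sum power2_diff)
qed

lemma hardy2_add:
  assumes "f \<in> hardy2" "g \<in> hardy2"
  shows "f + g \<in> hardy2"
proof -
  obtain a where a: "summable (\<lambda>n. (norm (a n))\<^sup>2)" "\<And>z. z \<in> ball 0 1 \<Longrightarrow> (\<lambda>n. z ^ n *\<^sub>C a n) sums f z"
    using hardy2E[OF assms(1)] by blast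
  obtain b where b: "summable (\<lambda>n. (norm (b n))\<^sup>2)" "\<And>z. z \<in> ball 0 1 \<Longrightarrow> (\<lambda>n. z ^ n *\<^sub>C b n) sums g z"
    using hardy2E[OF assms(2)] by blast
  show ?thesis
  proof (rule hardy2I)
    show "summable (\<lambda>n. (norm (a n + b n))\<^sup>2)" by (intro summable_norm_sq_add a b)
    show "(\<lambda>n. z ^ n *\<^sub>C (a n + b n)) sums (f + g) z" if "z \<in> ball 0 1" for z
      using sums_add[OF a(2)[OF that] b(2)[OF that]] by (simp add: scaleC_add_right)
  qed (use assms in \<open>simp add: hardy2_outside del: mem_ball\<close>)
qed

lemma hardy2_bcl:
  fixes T :: "'e::chilbert \<Rightarrow> 'f::chilbert"
  assumes "f \<in> hardy2" "bcl T"
  shows "(\<lambda>z. T (f z)) \<in> hardy2"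
proof -
  obtain a where a: "summable (\<lambda>n. (norm (a n))\<^sup>2)" "\<And>z. z \<in> ball 0 1 \<Longrightarrow> (\<lambda>n. z ^ n *\<^sub>C a n) sums f z"
    using hardy2E[OF assms(1)] by blast
  obtain K where K: "\<And>x. norm (T x) \<le> norm x * K"
    using bounded_linear.bounded[OF bcl_bounded_linear[OF assms(2)]] by blast
  show ?thesis
  proof (rule hardy2I)
    show "summable (\<lambda>n. (norm (T (a n)))\<^sup>2)"
    proof (rule summable_comparison_test')
      show "summable (\<lambda>n. (norm (a n))\<^sup>2 * K\<^sup>2)" using a(1) by (rule summable_mult2)
      show "norm ((norm (T (a n)))\<^sup>2) \<le> (norm (a n))\<^sup>2 * K\<^sup>2" for n
        using power_mono[OF K[of "a n"], of 2] by (simp add: power_mult_distrib)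
    qed
    show "(\<lambda>n. z ^ n *\<^sub>C T (a n)) sums T (f z)" if "z \<in> ball 0 1" for z
      using bounded_linear.sums[OF bcl_bounded_linear[OF assms(2)] a(2)[OF that]]
      by (simp add: bcl_scaleC[OF assms(2)])
  qed (use assms in \<open>simp add: hardy2_outside bcl_zero del: mem_ball\<close>)
qed

lemma hardy2_minus: "f \<in> hardy2 \<Longrightarrow> - f \<in> hardy2"
  using hardy2_bcl[OF _ bcl_smult[OF bcl_ident, of "-1"], of f] by (simp add: fun_Compl_def)

lemma hardy2_diff: "f \<in> hardy2 \<Longrightarrow> g \<in> hardy2 \<Longrightarrow> f - g \<in> hardy2"
  using hardy2_add[OF _ hardy2_minus, of f g] by simp

lemma hardy2_shift:
  assumes "f \<in> hardy2"
  shows "(\<lambda>z. z *\<^sub>C f z) \<in> hardy2"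
proof -
  obtain a where a: "summable (\<lambda>n. (norm (a n))\<^sup>2)" "\<And>z. z \<in> ball 0 1 \<Longrightarrow> (\<lambda>n. z ^ n *\<^sub>C a n) sums f z"
    using hardy2E[OF assms(1)] by blast
  define b where "b n = (case n of 0 \<Rightarrow> 0 | Suc m \<Rightarrow> a m)" for n
  show ?thesis
  proof (rule hardy2I)
    show "summable (\<lambda>n. (norm (b n))\<^sup>2)"
      using a(1) summable_Suc_iff[of "\<lambda>n. (norm (b n))\<^sup>2"] by (simp add: b_def)
    show "(\<lambda>n. z ^ n *\<^sub>C b n) sums (z *\<^sub>C f z)" if "z \<in> ball 0 1" for z
      using bounded_linear.sums[OF bounded_linear_scaleC_right a(2)[OF that], of z]
        sums_Suc_iff[of "\<lambda>n. z ^ n *\<^sub>C b n" "z *\<^sub>C f z"]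
      by (simp add: b_def)
  qed (use assms in \<open>simp add: hardy2_outside del: mem_ball\<close>)
qed

text \<open>Elements of \<open>hardy2\<close> are functions on the whole plane that are 0 off the
  disc, hence the cut-off.\<close>

definition hardy_const :: "'e::chilbert \<Rightarrow> complex \<Rightarrow> 'e" where
  "hardy_const u = (\<lambda>z. if z \<in> ball 0 1 then u else 0)"

lemma hardy_coeffs_const: "hardy_coeffs (hardy_const u) (\<lambda>n. if n = 0 then u else 0)"
  unfolding hardy_coeffs_def
proof (intro conjI ballI)
  have "(\<lambda>n. (norm (if n = 0 then u else 0))\<^sup>2) = (\<lambda>n. if n = 0 then (norm u)\<^sup>2 else 0)" by auto
  then show "summable (\<lambda>n. (norm (if n = 0 then u else (0::'a)))\<^sup>2)"
    using summable_finite[of "{0}" "\<lambda>n. (norm (if n = 0 then u else (0::'a)))\<^sup>2"] by simp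
  fix z :: complex assume "z \<in> ball 0 1"
  have "(\<lambda>n. z ^ n *\<^sub>C (if n = 0 then u else 0)) sums (\<Sum>n\<in>{0}. z ^ n *\<^sub>C (if n = 0 then u else 0))"
    by (rule sums_finite) auto
  then show "hardy_const u z = (\<Sum>n. z ^ n *\<^sub>C (if n = 0 then u else 0))"
    using \<open>z \<in> ball 0 1\<close> sums_unique[of _ u] by (simp add: hardy_const_def)
qed (auto simp: hardy_const_def)

lemma hardy_const_in: "hardy_const u \<in> hardy2"
  using hardy_coeffs_const hardy2_def by blast

text \<open>Cauchy-Schwarz between \<open>z ^ n\<close> and the coefficients. Replacing
  \<open>(cmod z ^ n)\<^sup>2\<close> by \<open>cmod z ^ n\<close> costs at most a factor 2 and
  keeps the growth of \<open>norm v\<close> of order \<open>1 / sqrt (1 - cmod z)\<close>.\<close>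

lemma hardy_coeffs_bound:
  fixes a :: "nat \<Rightarrow> 'e::chilbert"
  assumes a: "summable (\<lambda>n. (norm (a n))\<^sup>2)" and s: "(\<lambda>n. z ^ n *\<^sub>C a n) sums v" and z: "z \<in> ball 0 1"
  shows "(norm v)\<^sup>2 \<le> (\<Sum>n. (norm (a n))\<^sup>2) / (1 - cmod z)"
proof -
  define S where "S = (\<Sum>n. (norm (a n))\<^sup>2)"
  have z1: "cmod z < 1" using z by simp
  have "(norm (\<Sum>n<N. z ^ n *\<^sub>C a n))\<^sup>2 \<le> S / (1 - cmod z)" for N
  proof -
    have "norm (\<Sum>n<N. z ^ n *\<^sub>C a n) \<le> (\<Sum>n<N. cmod z ^ n * norm (a n))"
      by (rule order_trans[OF norm_sum]) (simp add: norm_scaleC norm_power)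
    then have "(norm (\<Sum>n<N. z ^ n *\<^sub>C a n))\<^sup>2 \<le> (\<Sum>n<N. cmod z ^ n * norm (a n))\<^sup>2"
      by (intro power_mono) auto
    also have "\<dots> \<le> (\<Sum>n<N. (cmod z ^ n)\<^sup>2) * (\<Sum>n<N. (norm (a n))\<^sup>2)"
      by (rule Cauchy_Schwarz_ineq_sum)
    also have "\<dots> \<le> (1 / (1 - cmod z)) * S"
    proof (rule mult_mono)
      have "(\<Sum>n<N. (cmod z ^ n)\<^sup>2) \<le> (\<Sum>n<N. cmod z ^ n)"
        using z1 by (intro sum_mono power_le_one) (simp add: power2_eq_square mult_left_le power_le_one)
      also have "\<dots> \<le> (\<Sum>n. cmod z ^ n)"
        using z1 by (intro sum_le_suminf summable_geometric) auto
      also have "\<dots> = 1 / (1 - cmod z)" using z1 by (simp add: suminf_geometric)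
      finally show "(\<Sum>n<N. (cmod z ^ n)\<^sup>2) \<le> 1 / (1 - cmod z)" .
      show "(\<Sum>n<N. (norm (a n))\<^sup>2) \<le> S"
        unfolding S_def using a by (intro sum_le_suminf) auto
    qed (use z1 in \<open>auto intro: sum_nonneg\<close>)
    finally show ?thesis by simp
  qed
  moreover have "(\<lambda>N. (norm (\<Sum>n<N. z ^ n *\<^sub>C a n))\<^sup>2) \<longlonglongrightarrow> (norm v)\<^sup>2"
    using s unfolding sums_def by (intro tendsto_intros)
  ultimately show ?thesis unfolding S_def by (intro LIMSEQ_le_const2) auto
qed

lemma hardy2_bound:
  assumes "f \<in> hardy2"
  obtains C where "C \<ge> 0" "\<And>z. z \<in> ball 0 1 \<Longrightarrow> norm (f z) * sqrt (1 - cmod z) \<le> C"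
proof -
  obtain a where a: "summable (\<lambda>n. (norm (a n))\<^sup>2)" "\<And>z. z \<in> ball 0 1 \<Longrightarrow> (\<lambda>n. z ^ n *\<^sub>C a n) sums f z"
    using hardy2E[OF assms(1)] by blast
  define S where "S = (\<Sum>n. (norm (a n))\<^sup>2)"
  have S0: "S \<ge> 0" unfolding S_def using a by (intro suminf_nonneg) auto
  have "norm (f z) * sqrt (1 - cmod z) \<le> sqrt S" if z: "z \<in> ball 0 1" for z
  proof (rule power2_le_imp_le)
    have "(norm (f z))\<^sup>2 * (1 - cmod z) \<le> S"
      using hardy_coeffs_bound[OF a(1) a(2)[OF z] z] z by (simp add: S_def field_simps)
    then show "(norm (f z) * sqrt (1 - cmod z))\<^sup>2 \<le> (sqrt S)\<^sup>2"
      using z S0 by (simp add: power_mult_distrib)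
  qed (use S0 in simp)
  then show thesis using that[of "sqrt S"] S0 by simp
qed

text \<open>One step of the identity theorem. Division by \<open>z\<close> leaves a series with sum
  \<open>- a 0 / z\<close>, unbounded near 0 unless \<open>a 0 = 0\<close>, although
  \<open>hardy_coeffs_bound\<close> bounds it there. The point 0 is excluded from the hypothesis so
  that the divided series satisfies it again.\<close>

lemma hardy_coeffs_head_zero:
  fixes a :: "nat \<Rightarrow> 'e::chilbert"
  assumes a: "summable (\<lambda>n. (norm (a n))\<^sup>2)"
    and s: "\<And>z. z \<in> ball 0 1 \<Longrightarrow> z \<noteq> 0 \<Longrightarrow> (\<lambda>n. z ^ n *\<^sub>C a n) sums 0"
  shows "a 0 = 0" and "\<And>z. z \<in> ball 0 1 \<Longrightarrow> z \<noteq> 0 \<Longrightarrow> (\<lambda>n. z ^ n *\<^sub>C a (Suc n)) sums 0"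
proof -
  define S where "S = (\<Sum>n. (norm (a (Suc n)))\<^sup>2)"
  have a': "summable (\<lambda>n. (norm (a (Suc n)))\<^sup>2)"
    using a summable_Suc_iff[of "\<lambda>n. (norm (a n))\<^sup>2"] by simp
  have S0: "S \<ge> 0" unfolding S_def using a' by (intro suminf_nonneg) auto
  have h: "(\<lambda>n. z ^ n *\<^sub>C a (Suc n)) sums ((- inverse z) *\<^sub>C a 0)" if z: "z \<in> ball 0 1" "z \<noteq> 0" for z
  proof -
    have "(\<lambda>n. z ^ Suc n *\<^sub>C a (Suc n)) sums (- a 0)"
      using s[OF z] sums_Suc_iff[of "\<lambda>n. z ^ n *\<^sub>C a n" "- a 0"] by simp
    from bounded_linear.sums[OF bounded_linear_scaleC_right this, of "inverse z"]
    moreover have "inverse z * z ^ Suc n = z ^ n" for n using z by simp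
    ultimately show ?thesis by (simp only: scaleC_scaleC) simp
  qed
  have le: "(norm (a 0))\<^sup>2 \<le> S * t" if t: "0 < t" "t \<le> 1 / 2" for t :: real
  proof -
    have "complex_of_real t \<in> ball 0 1" "complex_of_real t \<noteq> 0" using t by auto
    from hardy_coeffs_bound[OF a' h[OF this] this(1)]
    have "(norm (a 0) / t)\<^sup>2 \<le> S / (1 - t)"
      using t by (simp add: S_def norm_scaleC norm_divide norm_inverse field_simps)
    also have "\<dots> \<le> S / t" using t S0 by (intro divide_left_mono) auto
    finally show ?thesis using t by (simp add: field_simps power2_eq_square)
  qed
  show a0: "a 0 = 0"
  proof (rule ccontr)
    assume "a 0 \<noteq> 0"
    \<comment> \<open>Small enough that \<open>S * t\<close> is at most half of
      \<open>(norm (a 0))\<^sup>2\<close>; \<open>S + 1\<close> avoids dividing by 0.\<close>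
    define t where "t = min (1/2) ((norm (a 0))\<^sup>2 / (2 * (S + 1)))"
    have "t > 0" using \<open>a 0 \<noteq> 0\<close> S0 by (simp add: t_def)
    moreover have "t \<le> 1 / 2" unfolding t_def by (rule min.cobounded1)
    ultimately have "(norm (a 0))\<^sup>2 \<le> S * t" by (rule le)
    also have "\<dots> \<le> (S + 1) * ((norm (a 0))\<^sup>2 / (2 * (S + 1)))"
      using S0 \<open>t > 0\<close> by (intro mult_mono) (auto simp: t_def)
    also have "\<dots> = (norm (a 0))\<^sup>2 / 2" using S0 by (simp add: field_simps)
    finally show False using \<open>a 0 \<noteq> 0\<close> by simp
  qed
  show "(\<lambda>n. z ^ n *\<^sub>C a (Suc n)) sums 0" if "z \<in> ball 0 1" "z \<noteq> 0" for z
    using h[OF that] a0 by simp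
qed

lemma hardy_coeffs_zero:
  fixes a :: "nat \<Rightarrow> 'e::chilbert"
  assumes "summable (\<lambda>n. (norm (a n))\<^sup>2)"
    and "\<And>z. z \<in> ball 0 1 \<Longrightarrow> z \<noteq> 0 \<Longrightarrow> (\<lambda>n. z ^ n *\<^sub>C a n) sums 0"
  shows "a n = 0"
  using assms
proof (induction n arbitrary: a)
  case 0
  then show ?case using hardy_coeffs_head_zero(1)[of a] by blast
next
  case (Suc n)
  show ?case
  proof (rule Suc.IH[of "\<lambda>n. a (Suc n)"])
    show "summable (\<lambda>n. (norm (a (Suc n)))\<^sup>2)"
      using Suc.prems(1) summable_Suc_iff[of "\<lambda>n. (norm (a n))\<^sup>2"] by simp
  qed (rule hardy_coeffs_head_zero(2)[of a], use Suc.prems in auto)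
qed

text \<open>Makes the choice inside \<open>hardy_norm\<close> unambiguous; the difference of two
  coefficient sequences represents 0.\<close>

lemma hardy_coeffs_unique:
  assumes "hardy_coeffs f a" "hardy_coeffs f b"
  shows "a = b"
proof
  fix n
  have "summable (\<lambda>n. (norm (a n + - b n))\<^sup>2)"
    using assms by (intro summable_norm_sq_add) (auto simp: hardy_coeffs_def)
  moreover have "(\<lambda>n. z ^ n *\<^sub>C (a n + - b n)) sums 0" if "z \<in> ball 0 1" for z
    using sums_diff[OF hardy_coeffs_sums[OF assms(1) that] hardy_coeffs_sums[OF assms(2) that]]
    by (simp add: scaleC_diff_right)
  ultimately have "a n + - b n = 0" by (rule hardy_coeffs_zero)
  then show "a n = b n" by simp
qed

lemma hardy_norm_eq:
  assumes "hardy_coeffs f a"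
  shows "hardy_norm f = sqrt (\<Sum>n. (norm (a n))\<^sup>2)"
proof -
  have "(SOME a. hardy_coeffs f a) = a"
    using assms hardy_coeffs_unique by (intro some_equality) auto
  then show ?thesis by (simp add: hardy_norm_def)
qed

lemma hardy_coeffs_at_0: "hardy_coeffs f a \<Longrightarrow> f 0 = a 0"
proof -
  assume "hardy_coeffs f a"
  then have "(\<lambda>n. 0 ^ n *\<^sub>C a n) sums f 0" by (rule hardy_coeffs_sums) simp
  moreover have "(\<lambda>n. 0 ^ n *\<^sub>C a n) = (\<lambda>n. if n = 0 then a n else 0)"
    by (auto simp: power_0_left)
  ultimately show ?thesis using sums_single[of 0 a] sums_unique2 by metis
qed

text \<open>A substitute for the inner product of the Hardy space: the cross term shows that pairing
  a constant with \<open>f\<close> sees only \<open>f 0\<close>.\<close>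

lemma hardy_norm_add_const:
  assumes "f \<in> hardy2"
  shows "(hardy_norm (hardy_const u + f))\<^sup>2 = (norm u)\<^sup>2 + (hardy_norm f)\<^sup>2 + 2 * Re (cinner u (f 0))"
proof -
  obtain a where a: "hardy_coeffs f a" using assms by (auto simp: hardy2_def)
  have sa: "summable (\<lambda>n. (norm (a n))\<^sup>2)" using a by (simp add: hardy_coeffs_def)
  define b where "b n = (if n = 0 then u else 0) + a n" for n
  have b: "hardy_coeffs (hardy_const u + f) b"
    unfolding hardy_coeffs_def
  proof (intro conjI ballI allI impI)
    show sb: "summable (\<lambda>n. (norm (b n))\<^sup>2)"
      unfolding b_def using hardy_coeffs_const[of u] a
      by (intro summable_norm_sq_add) (auto simp: hardy_coeffs_def)
    show "(hardy_const u + f) z = (\<Sum>n. z ^ n *\<^sub>C b n)" if "z \<in> ball 0 1" for z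
      using sums_unique[OF sums_add[OF hardy_coeffs_sums[OF hardy_coeffs_const that] hardy_coeffs_sums[OF a that]]]
      by (simp add: b_def scaleC_add_right)
    show "(hardy_const u + f) z = 0" if "z \<notin> ball 0 1" for z
      using hardy2_outside[OF assms that] that by (simp add: hardy_const_def)
  qed
  have sb: "summable (\<lambda>n. (norm (b n))\<^sup>2)" using b by (simp add: hardy_coeffs_def)
  have "(hardy_norm (hardy_const u + f))\<^sup>2 = (\<Sum>n. (norm (b n))\<^sup>2)"
    using sb by (simp add: hardy_norm_eq[OF b] suminf_nonneg)
  also have "\<dots> = (norm (u + a 0))\<^sup>2 + (\<Sum>n. (norm (a (Suc n)))\<^sup>2)"
    using suminf_split_head[OF sb] by (simp add: b_def)
  also have "(\<Sum>n. (norm (a (Suc n)))\<^sup>2) = (hardy_norm f)\<^sup>2 - (norm (a 0))\<^sup>2"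
    using suminf_split_head[OF sa] sa by (simp add: hardy_norm_eq[OF a] suminf_nonneg)
  finally show ?thesis
    unfolding norm_add_sq hardy_coeffs_at_0[OF a] by linarith
qed

subsection \<open>Solving and obstructing the Koszul equation\<close>

lemma mult_op_apply: "mult_op a f w = (if w \<in> ball 0 1 then a w (f w) else 0)"
  by (simp add: mult_op_def)

lemma mult_op_const_in: "bcl T \<Longrightarrow> f \<in> hardy2 \<Longrightarrow> mult_op (\<lambda>_. T) f \<in> hardy2"
proof -
  assume T: "bcl T" and f: "f \<in> hardy2"
  have "mult_op (\<lambda>_. T) f = (\<lambda>z. T (f z))"
    using f T by (intro ext) (simp add: mult_op_apply hardy2_outside bcl_zero del: mem_ball)
  then show ?thesis using hardy2_bcl[OF f T] by simp
qed

text \<open>The algebraic conditions are pointwise in \<open>w\<close>; only the preservation of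
  \<open>hardy2\<close> is a global condition on the families.\<close>

lemma hardy_koszul_exact:
  assumes lin: "\<And>w. w \<in> ball 0 1 \<Longrightarrow> bcl (t1 w)" "\<And>w. w \<in> ball 0 1 \<Longrightarrow> bcl (t2 w)"
    and maps: "\<And>f. f \<in> hardy2 \<Longrightarrow> mult_op t1 f \<in> hardy2" "\<And>f. f \<in> hardy2 \<Longrightarrow> mult_op t2 f \<in> hardy2"
      "\<And>f. f \<in> hardy2 \<Longrightarrow> mult_op a f \<in> hardy2" "\<And>f. f \<in> hardy2 \<Longrightarrow> mult_op b f \<in> hardy2"
    and comm: "\<And>w x. w \<in> ball 0 1 \<Longrightarrow> t1 w (t2 w x) = t2 w (t1 w x)"
      "\<And>w x. w \<in> ball 0 1 \<Longrightarrow> a w (t1 w x) = t1 w (a w x)"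
      "\<And>w x. w \<in> ball 0 1 \<Longrightarrow> a w (t2 w x) = t2 w (a w x)"
      "\<And>w x. w \<in> ball 0 1 \<Longrightarrow> b w (t1 w x) = t1 w (b w x)"
      "\<And>w x. w \<in> ball 0 1 \<Longrightarrow> b w (t2 w x) = t2 w (b w x)"
    and split: "\<And>w x. w \<in> ball 0 1 \<Longrightarrow> a w (t1 w x) + b w (t2 w x) = x"
  shows "koszul_exact_on hardy2 (mult_op t1) (mult_op t2)"
  by (rule koszul_exactI[where A = "mult_op a" and B = "mult_op b"])
    (use assms in \<open>auto simp: fun_eq_iff mult_op_apply bcl_simps hardy2_add hardy2_minus
      hardy2_outside simp del: mem_ball\<close>)

text \<open>\<open>K\<close> is the fixed point of
  \<open>s \<mapsto> u 0 + suminf v + q * s\<close>; by the summed recursion, a partial sum below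
  \<open>K\<close> is followed by another one below \<open>K\<close>.\<close>

lemma summable_contractive_recursion:
  fixes u v :: "nat \<Rightarrow> real"
  assumes u: "\<And>n. 0 \<le> u n" and v: "\<And>n. 0 \<le> v n" "summable v" and q: "0 \<le> q" "q < 1"
    and rec: "\<And>n. u (Suc n) \<le> q * u n + v n"
  shows "summable u"
proof (rule summableI_nonneg_bounded[OF u])
  define K where "K = (u 0 + suminf v) / (1 - q)"
  have V: "suminf v \<ge> 0" using v by (simp add: suminf_nonneg)
  have K: "u 0 + suminf v + q * K = K" using q by (simp add: K_def field_simps)
  have K0: "K \<ge> 0" using u[of 0] V q by (simp add: K_def)
  show "(\<Sum>i<n. u i) \<le> K" for n
  proof (induction n)
    case (Suc n)
    have "(\<Sum>i<Suc n. u i) = u 0 + (\<Sum>i<n. u (Suc i))" by (rule sum.lessThan_Suc_shift)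
    also have "\<dots> \<le> u 0 + (\<Sum>i<n. q * u i + v i)" by (intro add_left_mono sum_mono rec)
    also have "\<dots> = u 0 + q * (\<Sum>i<n. u i) + (\<Sum>i<n. v i)"
      by (simp add: sum.distrib sum_distrib_left)
    also have "\<dots> \<le> u 0 + q * K + suminf v"
      using Suc.IH q v by (intro add_mono mult_left_mono sum_le_suminf) auto
    finally show ?case using K by simp
  qed (use K0 in simp)
qed

text \<open>The coefficients of \<open>g = (z V' - \<zeta>)\<^sup>-\<^sup>1 f\<close> satisfy a first-order recursion with ratio
  \<open>1 / \<bar>\<zeta>\<bar> < 1\<close>.\<close>
lemma hardy_resolvent:
  fixes T :: "'e::chilbert \<Rightarrow> 'e"
  assumes T: "bcl T" and normT: "\<And>x. norm (T x) = norm x" and \<zeta>: "cmod \<zeta> > 1" and f: "f \<in> hardy2"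
  obtains g where "g \<in> hardy2" "\<And>w. w \<in> ball 0 1 \<Longrightarrow> w *\<^sub>C T (g w) - \<zeta> *\<^sub>C g w = f w"
proof -
  obtain a where a: "summable (\<lambda>n. (norm (a n))\<^sup>2)" "\<And>z. z \<in> ball 0 1 \<Longrightarrow> (\<lambda>n. z ^ n *\<^sub>C a n) sums f z"
    using hardy2E[OF f] by blast
  define \<rho> where "\<rho> = cmod \<zeta>"
  have \<rho>: "\<rho> > 1" using \<zeta> by (simp add: \<rho>_def)
  have nz: "\<zeta> \<noteq> 0" using \<zeta> by auto
  \<comment> \<open>Comparing coefficients in \<open>w T g - \<zeta> g = f\<close>:
    \<open>- \<zeta> b 0 = a 0\<close> and
    \<open>T (b n) - \<zeta> b (Suc n) = a (Suc n)\<close>.\<close>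
  define b where "b = rec_nat (- (inverse \<zeta> *\<^sub>C a 0)) (\<lambda>n y. inverse \<zeta> *\<^sub>C (T y - a (Suc n)))"
  have b0: "b 0 = - (inverse \<zeta> *\<^sub>C a 0)" and bSuc: "b (Suc n) = inverse \<zeta> *\<^sub>C (T (b n) - a (Suc n))" for n
    by (simp_all add: b_def)
  have sum_b: "summable (\<lambda>n. (norm (b n))\<^sup>2)"
  proof (rule summable_contractive_recursion[where q = "1 / \<rho>" and v = "\<lambda>n. (norm (a (Suc n)))\<^sup>2 / (\<rho> * (\<rho> - 1))"])
    show "summable (\<lambda>n. (norm (a (Suc n)))\<^sup>2 / (\<rho> * (\<rho> - 1)))"
      using a(1) summable_Suc_iff[of "\<lambda>n. (norm (a n))\<^sup>2"] by (intro summable_divide) simp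
    fix n
    define x y where "x = norm (b n)" and "y = norm (a (Suc n))"
    have "norm (b (Suc n)) = norm (T (b n) - a (Suc n)) / \<rho>"
      by (simp add: bSuc norm_scaleC norm_inverse \<rho>_def divide_inverse mult.commute)
    also have "\<dots> \<le> (x + y) / \<rho>"
      using norm_triangle_ineq4[of "T (b n)" "a (Suc n)"] \<rho>
      by (intro divide_right_mono) (simp_all add: normT x_def y_def)
    finally have "(norm (b (Suc n)))\<^sup>2 \<le> ((x + y) / \<rho>)\<^sup>2" by (intro power_mono) auto
    also have "\<dots> \<le> 1 / \<rho> * x\<^sup>2 + y\<^sup>2 / (\<rho> * (\<rho> - 1))"
    proof -
      \<comment> \<open>Young's inequality with weight \<open>\<rho> - 1\<close>, chosen so that the
        factor \<open>1 / \<rho>\<^sup>2\<close> of \<open>x\<^sup>2\<close> grows only to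
        \<open>1 / \<rho>\<close>, still below 1.\<close>
      have "0 \<le> ((\<rho> - 1) * x - y)\<^sup>2" by simp
      then have "(\<rho> - 1) * (x + y)\<^sup>2 \<le> \<rho> * ((\<rho> - 1) * x\<^sup>2 + y\<^sup>2)"
        by (simp add: power2_eq_square algebra_simps)
      moreover have "1 / \<rho> * x\<^sup>2 + y\<^sup>2 / (\<rho> * (\<rho> - 1)) - ((x + y) / \<rho>)\<^sup>2 =
          (\<rho> * ((\<rho> - 1) * x\<^sup>2 + y\<^sup>2) - (\<rho> - 1) * (x + y)\<^sup>2) / (\<rho>\<^sup>2 * (\<rho> - 1))"
        using \<rho> by (simp add: divide_simps) (simp add: power2_eq_square algebra_simps)
      ultimately show ?thesis using \<rho> by (smt (verit) divide_nonneg_pos zero_less_power mult_pos_pos)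
    qed
    finally show "(norm (b (Suc n)))\<^sup>2 \<le> 1 / \<rho> * (norm (b n))\<^sup>2 + (norm (a (Suc n)))\<^sup>2 / (\<rho> * (\<rho> - 1))"
      by (simp add: x_def y_def)
  qed (use \<rho> in auto)
  define g where "g z = (if z \<in> ball 0 1 then \<Sum>n. z ^ n *\<^sub>C b n else 0)" for z
  have sums_g: "(\<lambda>n. z ^ n *\<^sub>C b n) sums g z" if "z \<in> ball 0 1" for z
    using summable_norm_cancel[OF hardy_summable[OF sum_b that]] that
    by (simp add: g_def summable_sums)
  have "g \<in> hardy2"
    by (rule hardy2I[OF sum_b sums_g]) (auto simp: g_def)
  moreover have "w *\<^sub>C T (g w) - \<zeta> *\<^sub>C g w = f w" if w: "w \<in> ball 0 1" for w
  proof -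
    have "(\<lambda>n. w *\<^sub>C T (w ^ n *\<^sub>C b n)) sums (w *\<^sub>C T (g w))"
      by (intro bounded_linear.sums[OF bcl_bounded_linear[OF bcl_smult[OF T]]] sums_g w)
    moreover have "(\<lambda>n. \<zeta> *\<^sub>C (w ^ n *\<^sub>C b n)) sums (\<zeta> *\<^sub>C g w)"
      by (intro bounded_linear.sums[OF bounded_linear_scaleC_right] sums_g w)
    then have "(\<lambda>n. \<zeta> *\<^sub>C (w ^ Suc n *\<^sub>C b (Suc n))) sums (\<zeta> *\<^sub>C g w - \<zeta> *\<^sub>C b 0)"
      using sums_Suc_iff[of "\<lambda>n. \<zeta> *\<^sub>C (w ^ n *\<^sub>C b n)" "\<zeta> *\<^sub>C g w - \<zeta> *\<^sub>C b 0"] by simp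
    ultimately have "(\<lambda>n. w *\<^sub>C T (w ^ n *\<^sub>C b n) - \<zeta> *\<^sub>C (w ^ Suc n *\<^sub>C b (Suc n)))
        sums (w *\<^sub>C T (g w) - (\<zeta> *\<^sub>C g w - \<zeta> *\<^sub>C b 0))"
      by (rule sums_diff)
    moreover have "w *\<^sub>C T (w ^ n *\<^sub>C b n) - \<zeta> *\<^sub>C (w ^ Suc n *\<^sub>C b (Suc n)) = w ^ Suc n *\<^sub>C a (Suc n)" for n
    proof -
      have "\<zeta> *\<^sub>C (w ^ Suc n *\<^sub>C b (Suc n)) = w ^ Suc n *\<^sub>C (\<zeta> *\<^sub>C b (Suc n))"
        by (simp add: mult.commute)
      also have "\<zeta> *\<^sub>C b (Suc n) = T (b n) - a (Suc n)"
        using nz by (simp add: bSuc)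
      finally show ?thesis
        by (simp add: bcl_simps[OF T] scaleC_diff_right)
    qed
    ultimately have "(\<lambda>n. w ^ Suc n *\<^sub>C a (Suc n)) sums (w *\<^sub>C T (g w) - (\<zeta> *\<^sub>C g w - \<zeta> *\<^sub>C b 0))"
      by simp
    moreover have "(\<lambda>n. w ^ Suc n *\<^sub>C a (Suc n)) sums (f w - a 0)"
      using a(2)[OF w] sums_Suc_iff[of "\<lambda>n. w ^ n *\<^sub>C a n" "f w - a 0"] by simp
    ultimately have "w *\<^sub>C T (g w) - (\<zeta> *\<^sub>C g w - \<zeta> *\<^sub>C b 0) = f w - a 0"
      by (rule sums_unique2)
    moreover have "\<zeta> *\<^sub>C b 0 = - a 0" using nz by (simp add: b0)
    ultimately show ?thesis by simp
  qed
  ultimately show thesis by (rule that)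
qed

section \<open>Inverse families and obstructions over one summand\<close>

context reduced_unitary
begin

text \<open>The inverse of \<open>N\<close> on \<open>range Q\<close>, preceded by \<open>Q\<close>
  so that it accepts every vector and inverses from the two summands can be added.\<close>

definition res :: "('e \<Rightarrow> 'e) \<Rightarrow> 'e \<Rightarrow> 'e" where
  "res N x = inv_into (range Q) N (Q x)"

context
  fixes N :: "'e \<Rightarrow> 'e"
  assumes bij: "bij_betw N (range Q) (range Q)" and NQ: "\<And>x. Q (N x) = N (Q x)"
begin

lemma N_res: "N (res N x) = Q x"
  unfolding res_def using bij by (intro f_inv_into_f) (simp add: bij_betw_def)

lemma Q_res: "Q (res N x) = res N x"
  unfolding range_Q_iff[symmetric] res_def using bij by (intro inv_into_into) (simp add: bij_betw_def)

lemma res_eqI: "N y = Q x \<Longrightarrow> Q y = y \<Longrightarrow> res N x = y"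
  using bij inj_onD[of N "range Q" "res N x" y] N_res[of x] Q_res[of x]
  by (simp add: range_Q_iff bij_betw_def)

lemma res_N: "res N (N x) = Q x"
  by (rule res_eqI) (simp_all add: NQ)

lemma res_Q: "res N (Q x) = res N x"
  by (simp add: res_def)

lemma res_commute:
  assumes "\<And>x. S (N x) = N (S x)" "\<And>x. S (Q x) = Q (S x)"
  shows "res N (S x) = S (res N x)"
  by (rule res_eqI) (simp_all add: assms(1)[symmetric] assms(2)[symmetric] N_res Q_res)

lemma bcl_res:
  assumes N: "bcl N" and c: "c > 0" "\<And>x. x \<in> range Q \<Longrightarrow> c * norm x \<le> norm (N x)"
  shows "bcl (res N)"
proof -
  obtain K where K: "\<And>x. norm (Q x) \<le> norm x * K"
    using bounded_linear.bounded[OF bcl_bounded_linear[OF bcl_Q]] by blast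
  show ?thesis
  proof (rule bclI[where K = "K / c"])
    show "res N (x + y) = res N x + res N y" for x y
      by (rule res_eqI) (simp_all add: bcl_simps[OF N] N_res Q_res lin)
    show "res N (l *\<^sub>C x) = l *\<^sub>C res N x" for l x
      by (rule res_eqI) (simp_all add: bcl_simps[OF N] N_res Q_res lin)
    show "norm (res N x) \<le> norm x * (K / c)" for x
    proof -
      have "res N x \<in> range Q" by (simp add: range_Q_iff Q_res)
      from c(2)[OF this] K[of x] have "c * norm (res N x) \<le> norm x * K"
        by (simp add: N_res)
      then show ?thesis using c(1) by (simp add: field_simps)
    qed
  qed
qed

end

text \<open>If \<open>l\<close> is outside the spectrum, the constant family inverting
  \<open>V - l\<close> works; otherwise \<open>1 \<le> cmod z\<close>, and \<open>w V' - z\<close>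
  is invertible for every \<open>w\<close> in the open disc. The clause on \<open>S\<close> is
  naturality, later applied to the symbols themselves to obtain commutation. Preservation of
  \<open>hardy2\<close> is claimed only off the closed-disc set because
  \<open>hardy_resolvent\<close> asks for \<open>cmod z > 1\<close>.\<close>

lemma spec_complement_inverse:
  assumes zl: "(z, l) \<notin> ball 0 1 \<times> \<sigma>"
  obtains \<alpha> \<beta> :: "complex \<Rightarrow> 'e \<Rightarrow> 'e" where
    "\<And>w x. w \<in> ball 0 1 \<Longrightarrow> \<alpha> w (w *\<^sub>C V' x - z *\<^sub>C x) + \<beta> w (V x - l *\<^sub>C x) = Q x"
    "\<And>w x. w \<in> ball 0 1 \<Longrightarrow> \<alpha> w (Q x) = \<alpha> w x" "\<And>w x. w \<in> ball 0 1 \<Longrightarrow> \<beta> w (Q x) = \<beta> w x"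
    "\<And>w S x. w \<in> ball 0 1 \<Longrightarrow> bcl S \<Longrightarrow> (\<And>x. S (V x) = V (S x)) \<Longrightarrow> (\<And>x. S (Q x) = Q (S x)) \<Longrightarrow>
       \<alpha> w (S x) = S (\<alpha> w x) \<and> \<beta> w (S x) = S (\<beta> w x)"
    "\<And>f. (z, l) \<notin> cball 0 1 \<times> \<sigma> \<Longrightarrow> f \<in> hardy2 \<Longrightarrow> mult_op \<alpha> f \<in> hardy2 \<and> mult_op \<beta> f \<in> hardy2"
proof (cases "l \<in> \<sigma>")
  case False
  define N where "N x = V x - l *\<^sub>C x" for x
  have bij: "bij_betw N (range Q) (range Q)"
    using False by (simp add: spec_on_def N_def[abs_def])
  have NQ: "Q (N x) = N (Q x)" for x by (simp add: N_def lin QV)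
  have N: "bcl N" unfolding N_def by (intro bcl_sub bcl_smult V bcl_ident)
  have "bcl (res N)"
    using bcl_res[OF bij NQ N] False unfolding not_in_spec_iff N_def by blast
  then have maps: "f \<in> hardy2 \<Longrightarrow> mult_op (\<lambda>_. res N) f \<in> hardy2" for f
    by (rule mult_op_const_in)
  have zero: "mult_op (\<lambda>_ _. 0) f \<in> hardy2" if "f \<in> hardy2" for f :: "complex \<Rightarrow> 'e"
    using that by (intro mult_op_const_in) (auto intro: bclI[where K = 0])
  show thesis
  proof (rule that[of "\<lambda>_ _. 0" "\<lambda>_. res N"])
    show "0 + res N (V x - l *\<^sub>C x) = Q x" for x
      by (simp add: N_def[symmetric] res_N[OF bij NQ])
    show "res N (Q x) = res N x" for x by (rule res_Q[OF bij NQ])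
    fix S x assume S: "bcl S" "\<And>x. S (V x) = V (S x)" "\<And>x. S (Q x) = Q (S x)"
    have "res N (S x) = S (res N x)"
      using S by (intro res_commute[OF bij NQ]) (simp_all add: N_def bcl_simps)
    then show "0 = S 0 \<and> res N (S x) = S (res N x)" using S(1) by (simp add: bcl_zero)
  qed (use maps zero in auto)
next
  case True
  then have z: "1 \<le> cmod z" using zl by auto
  define N where "N w x = w *\<^sub>C V' x - z *\<^sub>C x" for w x
  have bij: "bij_betw (N w) (range Q) (range Q)" if w: "w \<in> ball 0 1" for w
  proof -
    have "(cmod z - cmod w) * norm x \<le> norm (w *\<^sub>C V' x + (- z) *\<^sub>C x)" for x
      using norm_triangle_ineq2[of "z *\<^sub>C x" "w *\<^sub>C V' x"]
      by (simp add: norm_scaleC norm_V' left_diff_distrib norm_minus_commute)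
    moreover have "cmod z - cmod w > 0" using z w by simp
    ultimately show ?thesis
      using reduced_unitary.bounded_below_imp_bij[OF dual, of "cmod z - cmod w" w "- z"]
      by (simp add: N_def[abs_def])
  qed
  have NQ: "Q (N w x) = N w (Q x)" for w x by (simp add: N_def lin QV')
  have zero: "mult_op (\<lambda>_ _. 0) f \<in> hardy2" if "f \<in> hardy2" for f :: "complex \<Rightarrow> 'e"
    using that by (intro mult_op_const_in) (auto intro: bclI[where K = 0])
  show thesis
  proof (rule that[of "\<lambda>w. res (N w)" "\<lambda>_ _. 0"])
    show "res (N w) (w *\<^sub>C V' x - z *\<^sub>C x) + 0 = Q x" if "w \<in> ball 0 1" for w x
      by (simp add: N_def[symmetric] res_N[OF bij[OF that] NQ])
    show "res (N w) (Q x) = res (N w) x" if "w \<in> ball 0 1" for w x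
      by (rule res_Q[OF bij[OF that] NQ])
    show "res (N w) (S x) = S (res (N w) x) \<and> 0 = S 0"
      if "w \<in> ball 0 1" and S: "bcl S" "\<And>x. S (V x) = V (S x)" "\<And>x. S (Q x) = Q (S x)" for w S x
    proof -
      have "S (V' x) = V' (S x)" for x using S(2)[of "V' x"] by (metis VV' V'V)
      then show ?thesis
        using S by (auto intro!: res_commute[OF bij[OF that(1)] NQ] simp: N_def bcl_simps)
    qed
    fix f :: "complex \<Rightarrow> 'e" assume "(z, l) \<notin> cball 0 1 \<times> \<sigma>" and f: "f \<in> hardy2"
    then have "cmod z > 1" using True by auto
    obtain g where g: "g \<in> hardy2" "\<And>w. w \<in> ball 0 1 \<Longrightarrow> w *\<^sub>C V' (g w) - z *\<^sub>C g w = f w"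
      using hardy_resolvent[OF V' norm_V' \<open>cmod z > 1\<close> f] by blast
    \<comment> \<open>Membership in \<open>hardy2\<close> is not read off from the fibrewise
      inverses but from the resolvent solution \<open>g\<close>: by injectivity of
      \<open>N w\<close> on \<open>range Q\<close> the inverse of \<open>f w\<close> is
      \<open>Q (g w)\<close>.\<close>
    have "mult_op (\<lambda>w. res (N w)) f = mult_op (\<lambda>_. Q) g"
    proof
      show "mult_op (\<lambda>w. res (N w)) f w = mult_op (\<lambda>_. Q) g w" for w
      proof (cases "w \<in> ball 0 1")
        case True
        have "N w (Q (g w)) = Q (f w)"
          unfolding NQ[symmetric] using g(2)[OF True] by (simp add: N_def)
        then have "res (N w) (f w) = Q (g w)"
          by (intro res_eqI[OF bij[OF True] NQ]) simp_all
        then show ?thesis by (simp add: mult_op_apply)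
      qed (simp add: mult_op_apply)
    qed
    then show "mult_op (\<lambda>w. res (N w)) f \<in> hardy2 \<and> mult_op (\<lambda>_ _. 0) f \<in> hardy2"
      using mult_op_const_in[OF bcl_Q g(1)] zero[OF f] by simp
  qed simp_all
qed

lemma not_surj_interior:
  assumes l: "l \<in> \<sigma>"
  obtains e where "\<And>x y. Q e \<noteq> ((z * l) *\<^sub>C V' (Q x) - z *\<^sub>C Q x) + (V (Q y) - l *\<^sub>C Q y)"
proof -
  obtain e where e: "e \<in> range Q" "\<And>x. x \<in> range Q \<Longrightarrow> V x - l *\<^sub>C x \<noteq> e"
    using spec_not_surj[OF l] by blast
  have "Q e \<noteq> ((z * l) *\<^sub>C V' (Q x) - z *\<^sub>C Q x) + (V (Q y) - l *\<^sub>C Q y)" for x y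
  proof -
    define k where "k = Q y - z *\<^sub>C V' (Q x)"
    have "k \<in> range Q" by (simp add: k_def range_Q_iff lin QV')
    moreover have "V k - l *\<^sub>C k = ((z * l) *\<^sub>C V' (Q x) - z *\<^sub>C Q x) + (V (Q y) - l *\<^sub>C Q y)"
      by (simp add: k_def lin scaleC_simps mult.commute)
    ultimately show ?thesis using e by (metis range_Q_iff)
  qed
  then show thesis by (rule that)
qed

text \<open>On \<open>\<bar>z\<bar> = 1\<close> evaluate at \<open>w\<^sub>n = (1 - 1/n\<^sup>2) z l\<close> against approximate eigenvectors \<open>x\<^sub>n\<close> with
  \<open>\<parallel>(V - l) x\<^sub>n\<parallel> \<le> 1/n\<^sup>2\<close>: as functions of the Hardy space grow at most like \<open>(1 - \<bar>w\<bar>)\<^bsup>-1/2\<^esup>\<close>,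
  solvability for every \<open>e\<close> would make \<open>n x\<^sub>n\<close> weakly bounded.\<close>
lemma not_surj_hardy:
  assumes l: "l \<in> \<sigma>" and z: "cmod z \<le> 1"
  obtains e where "\<And>g h. g \<in> hardy2 \<Longrightarrow> h \<in> hardy2 \<Longrightarrow>
    \<exists>w\<in>ball 0 1. Q e \<noteq> (w *\<^sub>C V' (Q (g w)) - z *\<^sub>C Q (g w)) + (V (Q (h w)) - l *\<^sub>C Q (h w))"
proof (cases "cmod z < 1")
  case True
  obtain e where e: "\<And>x y. Q e \<noteq> ((z * l) *\<^sub>C V' (Q x) - z *\<^sub>C Q x) + (V (Q y) - l *\<^sub>C Q y)"
    using not_surj_interior[OF l, of z] by blast
  have "z * l \<in> ball 0 1" using True norm_spec[OF l] by (simp add: norm_mult)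
  then show thesis using that e by blast
next
  case False
  then have z1: "cmod z = 1" using z by simp
  have l1: "cmod l = 1" by (rule norm_spec[OF l])
  show thesis
  proof (rule ccontr)
    assume contra: "\<not> thesis"
    have solv: "\<exists>g\<in>hardy2. \<exists>h\<in>hardy2. \<forall>w\<in>ball 0 1.
      Q e = (w *\<^sub>C V' (Q (g w)) - z *\<^sub>C Q (g w)) + (V (Q (h w)) - l *\<^sub>C Q (h w))" for e
      using that[of e] contra by blast
    define d where "d n = 1 / (real (Suc n))\<^sup>2" for n
    have d: "0 < d n" "d n \<le> 1" for n by (auto simp: d_def divide_simps)
    have "\<exists>x\<in>range Q. norm (V x - l *\<^sub>C x) < d n * norm x" for n
    proof (rule ccontr)
      assume "\<not> ?thesis"
      then have "\<forall>x\<in>range Q. d n * norm x \<le> norm (V x - l *\<^sub>C x)" by (simp add: not_less)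
      then show False using not_in_spec_iff[of l] l d(1)[of n] by blast
    qed
    then obtain x where x: "\<And>n. x n \<in> range Q" "\<And>n. norm (V (x n) - l *\<^sub>C x n) < d n * norm (x n)"
      by metis
    have nz: "norm (x n) > 0" for n
      using x(2)[of n] by (cases "x n = 0") (auto simp: lin)
    define y where "y n = complex_of_real (Suc n / norm (x n)) *\<^sub>C x n" for n
    have "\<exists>C. \<forall>n. cmod (cinner (y n) e) \<le> C" for e
    proof -
      obtain g h where gh: "g \<in> hardy2" "h \<in> hardy2" "\<And>w. w \<in> ball 0 1 \<Longrightarrow>
        Q e = (w *\<^sub>C V' (Q (g w)) - z *\<^sub>C Q (g w)) + (V (Q (h w)) - l *\<^sub>C Q (h w))"
        using solv[of e] by blast
      obtain C where C: "\<And>w. w \<in> ball 0 1 \<Longrightarrow> norm (Q (g w)) * sqrt (1 - cmod w) \<le> C"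
        using hardy2_bound[OF hardy2_bcl[OF gh(1) bcl_Q]] by blast
      obtain D where D: "\<And>w. w \<in> ball 0 1 \<Longrightarrow> norm (Q (h w)) * sqrt (1 - cmod w) \<le> D"
        using hardy2_bound[OF hardy2_bcl[OF gh(2) bcl_Q]] by blast
      have "cmod (cinner (y n) e) \<le> 2 * C + D" for n
      proof -
        define w where "w = complex_of_real (1 - d n) * (z * l)"
        have cw: "cmod w = 1 - d n" using d[of n] by (simp add: w_def norm_mult z1 l1 del: of_real_diff)
        then have w: "w \<in> ball 0 1" using d(1)[of n] by simp
        have sq: "sqrt (1 - cmod w) = 1 / Suc n" by (simp add: cw d_def real_sqrt_divide)
        define G H where "G = Q (g w)" and "H = Q (h w)"
        have G: "norm G \<le> Suc n * C" and H: "norm H \<le> Suc n * D"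
          using C[OF w] D[OF w] unfolding sq G_def H_def
          by (simp_all add: field_simps del: of_nat_Suc)
        define k where "k = H - z *\<^sub>C V' G"
        \<comment> \<open>Moving from \<open>z l\<close> on the circle to \<open>w\<close> inside
          the disc costs an error term with coefficient of modulus \<open>d n\<close>.\<close>
        have "w *\<^sub>C V' G = (z * l) *\<^sub>C V' G - (complex_of_real (d n) * (z * l)) *\<^sub>C V' G"
          by (simp only: scaleC_diff_left[symmetric] w_def) (simp add: algebra_simps)
        then have "Q e = (V k - l *\<^sub>C k) - (complex_of_real (d n) * (z * l)) *\<^sub>C V' G"
          using gh(3)[OF w, folded G_def H_def] by (simp add: k_def lin scaleC_simps mult.commute)
        moreover have "cinner (x n) e = cinner (x n) (Q e)"
          using x(1)[of n] by (metis Q_cinner range_Q_iff)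
        ultimately have "cmod (cinner (x n) e) \<le>
            cmod (cinner (x n) (V k - l *\<^sub>C k)) + d n * cmod (cinner (x n) (V' G))"
          using norm_triangle_ineq4[of "cinner (x n) (V k - l *\<^sub>C k)"
              "(complex_of_real (d n) * (z * l)) * cinner (x n) (V' G)"] d(1)[of n]
          by (simp add: cinner_diff_right[of _ "V k - l *\<^sub>C k"] cinner_scaleC_right norm_mult z1 l1)
        also have "\<dots> \<le> d n * norm (x n) * norm k + d n * (norm (x n) * norm G)"
          using d(1)[of n] less_imp_le[OF x(2)[of n]] norm_cinner_le[of "x n" "V' G"]
          by (intro add_mono order_trans[OF cinner_V_minus] mult_right_mono mult_left_mono)
            (simp_all add: norm_V')
        also have "\<dots> \<le> d n * norm (x n) * (norm H + norm G) + d n * (norm (x n) * norm G)"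
          using norm_triangle_ineq4[of H "z *\<^sub>C V' G"] d(1)[of n]
          by (intro add_right_mono mult_left_mono) (simp_all add: k_def norm_scaleC norm_V' z1)
        also have "\<dots> = d n * norm (x n) * (2 * norm G + norm H)" by (simp add: algebra_simps)
        also have "\<dots> \<le> d n * norm (x n) * (Suc n * (2 * C + D))"
          using G H d(1)[of n] by (intro mult_left_mono) (simp_all add: algebra_simps)
        finally have "cmod (cinner (x n) e) \<le> d n * norm (x n) * (Suc n * (2 * C + D))" .
        \<comment> \<open>One factor \<open>Suc n\<close> from \<open>y\<close> and one from the
          growth bound cancel against \<open>d n\<close>, leaving a bound independent of
          \<open>n\<close>.\<close>
        then have "Suc n / norm (x n) * cmod (cinner (x n) e)
            \<le> Suc n / norm (x n) * (d n * norm (x n) * (Suc n * (2 * C + D)))"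
          by (intro mult_left_mono) auto
        also have "\<dots> = 2 * C + D"
          using nz[of n] by (simp add: d_def power2_eq_square del: of_nat_Suc)
        finally show ?thesis
          by (simp add: y_def cinner_scaleC_left norm_mult norm_divide del: of_nat_Suc)
      qed
      then show ?thesis by blast
    qed
    then obtain K where K: "\<And>n. norm (y n) \<le> K"
      using weakly_bounded_imp_bounded by blast
    have Suc_le: "real (Suc n) \<le> K" for n
      using K[of n] nz[of n] by (simp add: y_def norm_scaleC norm_divide norm_mult del: of_nat_Suc)
    obtain n where "K < real n" using reals_Archimedean2 by blast
    moreover have "real n + 1 \<le> K" using Suc_le[of n] by simp
    ultimately show False by linarith
  qed
qed

end

subsection \<open>The split symbols\<close>

lemma unitary_isometry: "unitary U \<Longrightarrow> isometry U"
  by (simp add: unitary_def)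

lemma phi_in_hardy2:
  assumes P: "orth_proj P" and U: "unitary U" and f: "f \<in> hardy2"
  shows "mult_op (phi1 P U) f \<in> hardy2" "mult_op (phi2 P U) f \<in> hardy2"
proof -
  have bcl: "bcl P" "bcl U" "bcl (adj U)"
    using P U by (auto simp: orth_proj_def unitary_def isometry_def intro!: bcl_adj)
  have "(\<lambda>z. adj U (((\<lambda>z. f z - P (f z)) + (\<lambda>z. z *\<^sub>C P (f z))) z)) \<in> hardy2"
    by (rule hardy2_bcl[OF hardy2_add[OF hardy2_bcl[OF f bcl_sub[OF bcl_ident bcl(1)]]
            hardy2_shift[OF hardy2_bcl[OF f bcl(1)]]] bcl(3)])
  also have "(\<lambda>z. adj U (((\<lambda>z. f z - P (f z)) + (\<lambda>z. z *\<^sub>C P (f z))) z)) = mult_op (phi1 P U) f"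
    using f bcl by (intro ext) (simp add: mult_op_apply phi1_def hardy2_outside bcl_zero del: mem_ball)
  finally show "mult_op (phi1 P U) f \<in> hardy2" .
  note PU = bcl_comp[OF bcl(1,2)]
  have "(\<lambda>z. P (U (f z))) + (\<lambda>z. z *\<^sub>C (U (f z) - P (U (f z)))) \<in> hardy2"
    by (rule hardy2_add[OF hardy2_bcl[OF f PU] hardy2_shift[OF hardy2_bcl[OF f bcl_sub[OF bcl(2) PU]]]])
  also have "(\<lambda>z. P (U (f z))) + (\<lambda>z. z *\<^sub>C (U (f z) - P (U (f z)))) = mult_op (phi2 P U) f"
    using f bcl by (intro ext) (simp add: mult_op_apply phi2_def hardy2_outside bcl_zero del: mem_ball)
  finally show "mult_op (phi2 P U) f \<in> hardy2" .
qed

lemma fscaleC_in_hardy2: "f \<in> hardy2 \<Longrightarrow> fscaleC c f \<in> hardy2"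
  unfolding fscaleC_def by (rule hardy2_bcl[OF _ bcl_smult[OF bcl_ident]])

text \<open>Commutation of \<open>P\<close> with \<open>U\<close> is all that the vanishing defect
  contributes to the computation of the spectra; the isometries do not appear here.\<close>

locale commuting_bcl =
  fixes P U :: "'e::chilbert \<Rightarrow> 'e"
  assumes P: "orth_proj P" and U: "unitary U" and PU: "P (U x) = U (P x)"
begin

abbreviation "U' \<equiv> adj U"
abbreviation "P' \<equiv> \<lambda>x. x - P x"
abbreviation "\<sigma>\<^sub>1 \<equiv> spec_on (range P) U"
abbreviation "\<sigma>\<^sub>2 \<equiv> spec_on (range P') U'"

lemma bcl_P: "bcl P" and bcl_U: "bcl U" and bcl_U': "bcl U'"
  using P U by (auto simp: orth_proj_def unitary_def isometry_def intro!: bcl_adj)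

lemma PP [simp]: "P (P x) = P x"
  using P by (simp add: orth_proj_def)

lemma UU' [simp]: "U (U' x) = x" and U'U [simp]: "U' (U x) = x"
  using unitary_adj[OF U] isometry_adj[OF unitary_isometry[OF U]] by auto

sublocale R1: reduced_unitary P U U'
  by unfold_locales (simp_all add: P bcl_U bcl_U' PU adj_cinner)

lemma P'_proj: "orth_proj P'"
  unfolding orth_proj_def using P
  by (auto simp: bcl_simps[OF bcl_P] cinner_simps orth_proj_def intro: bcl_sub bcl_ident)

sublocale R2: reduced_unitary P' U' U
  by unfold_locales
    (simp_all add: P'_proj bcl_U bcl_U' R1.V'_cinner R1.QV' bcl_simps[OF bcl_U'])

lemmas lin = R1.lin

abbreviation "t1 z w x \<equiv> phi1 P U w x - z *\<^sub>C x"
abbreviation "t2 z w x \<equiv> phi2 P U w x - z *\<^sub>C x"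

lemmas phi_simps = phi1_def phi2_def lin scaleC_simps R1.QV R1.QV'

lemma bcl_phi1: "bcl (phi1 P U w)" and bcl_phi2: "bcl (phi2 P U w)"
  unfolding phi1_def phi2_def
  by (intro bcl_plus bcl_sub bcl_smult bcl_comp[OF bcl_U'] bcl_comp[OF bcl_P] bcl_ident bcl_P bcl_U)+

lemma bcl_t1: "bcl (t1 z w)" and bcl_t2: "bcl (t2 z w)"
  by (intro bcl_sub bcl_smult bcl_ident bcl_phi1 bcl_phi2)+

section \<open>The symbols on \<open>ran P\<close> and on its complement\<close>

lemma P_t1: "P (t1 z w x) = w *\<^sub>C U' (P x) - z *\<^sub>C P x"
  and P_t2: "P (t2 z w x) = U (P x) - z *\<^sub>C P x"
  and P'_t1: "P' (t1 z w x) = U' (P' x) - z *\<^sub>C P' x"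
  and P'_t2: "P' (t2 z w x) = w *\<^sub>C U (P' x) - z *\<^sub>C P' x"
  by (simp_all add: phi_simps algebra_simps)

lemma t1_t2: "t1 z w (t2 y w x) = t2 y w (t1 z w x)"
  by (simp add: phi_simps mult_ac algebra_simps)

lemma t_commutes:
  "t1 z w (U x) = U (t1 z w x)" "t1 z w (U' x) = U' (t1 z w x)"
  "t1 z w (P x) = P (t1 z w x)" "t1 z w (P' x) = P' (t1 z w x)"
  "t2 z w (U x) = U (t2 z w x)" "t2 z w (U' x) = U' (t2 z w x)"
  "t2 z w (P x) = P (t2 z w x)" "t2 z w (P' x) = P' (t2 z w x)"
  by (simp_all add: phi_simps algebra_simps)

text \<open>Inverses for the two summands are added. On the complement of \<open>ran P\<close> the
  coordinates trade places: \<open>b2\<close> goes with the first operator and \<open>a2\<close>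
  with the second, and the spectral condition is put on \<open>(z2, z1)\<close>. Commutation follows
  from naturality with the symbols as \<open>S\<close>.\<close>

lemma complement_inverse:
  assumes "(z1, z2) \<notin> ball 0 1 \<times> \<sigma>\<^sub>1 \<union> \<sigma>\<^sub>2 \<times> ball 0 1"
  obtains a b :: "complex \<Rightarrow> 'e \<Rightarrow> 'e" where
    "\<And>w x. w \<in> ball 0 1 \<Longrightarrow> a w (t1 z1 w x) + b w (t2 z2 w x) = x"
    "\<And>w x. w \<in> ball 0 1 \<Longrightarrow> a w (t1 z1 w x) = t1 z1 w (a w x)"
    "\<And>w x. w \<in> ball 0 1 \<Longrightarrow> a w (t2 z2 w x) = t2 z2 w (a w x)"
    "\<And>w x. w \<in> ball 0 1 \<Longrightarrow> b w (t1 z1 w x) = t1 z1 w (b w x)"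
    "\<And>w x. w \<in> ball 0 1 \<Longrightarrow> b w (t2 z2 w x) = t2 z2 w (b w x)"
    "\<And>f. (z1, z2) \<notin> cball 0 1 \<times> \<sigma>\<^sub>1 \<union> \<sigma>\<^sub>2 \<times> cball 0 1 \<Longrightarrow> f \<in> hardy2 \<Longrightarrow>
      mult_op a f \<in> hardy2 \<and> mult_op b f \<in> hardy2"
proof -
  have "(z1, z2) \<notin> ball 0 1 \<times> \<sigma>\<^sub>1" using assms by blast
  then obtain a1 b1 where
    1: "\<And>w x. w \<in> ball 0 1 \<Longrightarrow> a1 w (w *\<^sub>C U' x - z1 *\<^sub>C x) + b1 w (U x - z2 *\<^sub>C x) = P x"
    "\<And>w x. w \<in> ball 0 1 \<Longrightarrow> a1 w (P x) = a1 w x" "\<And>w x. w \<in> ball 0 1 \<Longrightarrow> b1 w (P x) = b1 w x"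
    "\<And>w S x. w \<in> ball 0 1 \<Longrightarrow> bcl S \<Longrightarrow> (\<And>x. S (U x) = U (S x)) \<Longrightarrow> (\<And>x. S (P x) = P (S x)) \<Longrightarrow>
       a1 w (S x) = S (a1 w x) \<and> b1 w (S x) = S (b1 w x)"
    "\<And>f. (z1, z2) \<notin> cball 0 1 \<times> \<sigma>\<^sub>1 \<Longrightarrow> f \<in> hardy2 \<Longrightarrow> mult_op a1 f \<in> hardy2 \<and> mult_op b1 f \<in> hardy2"
    by (rule R1.spec_complement_inverse) blast
  have "(z2, z1) \<notin> ball 0 1 \<times> \<sigma>\<^sub>2" using assms by blast
  then obtain a2 b2 where
    2: "\<And>w x. w \<in> ball 0 1 \<Longrightarrow> a2 w (w *\<^sub>C U x - z2 *\<^sub>C x) + b2 w (U' x - z1 *\<^sub>C x) = P' x"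
    "\<And>w x. w \<in> ball 0 1 \<Longrightarrow> a2 w (P' x) = a2 w x" "\<And>w x. w \<in> ball 0 1 \<Longrightarrow> b2 w (P' x) = b2 w x"
    "\<And>w S x. w \<in> ball 0 1 \<Longrightarrow> bcl S \<Longrightarrow> (\<And>x. S (U' x) = U' (S x)) \<Longrightarrow> (\<And>x. S (P' x) = P' (S x)) \<Longrightarrow>
       a2 w (S x) = S (a2 w x) \<and> b2 w (S x) = S (b2 w x)"
    "\<And>f. (z2, z1) \<notin> cball 0 1 \<times> \<sigma>\<^sub>2 \<Longrightarrow> f \<in> hardy2 \<Longrightarrow> mult_op a2 f \<in> hardy2 \<and> mult_op b2 f \<in> hardy2"
    by (rule R2.spec_complement_inverse) blast
  define a b where "a w x = a1 w x + b2 w x" and "b w x = b1 w x + a2 w x" for w x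
  show thesis
  proof (rule that[of a b])
    fix w :: complex and x assume w: "w \<in> ball 0 1"
    \<comment> \<open>Each family absorbs its own projection, so it sees only the corresponding
      compression of the symbol.\<close>
    have "a1 w (t1 z1 w x) = a1 w (w *\<^sub>C U' (P x) - z1 *\<^sub>C P x)"
      "b1 w (t2 z2 w x) = b1 w (U (P x) - z2 *\<^sub>C P x)"
      using 1(2)[OF w, of "t1 z1 w x"] 1(3)[OF w, of "t2 z2 w x"] by (simp_all only: P_t1 P_t2)
    moreover have "a2 w (t2 z2 w x) = a2 w (w *\<^sub>C U (P' x) - z2 *\<^sub>C P' x)"
      "b2 w (t1 z1 w x) = b2 w (U' (P' x) - z1 *\<^sub>C P' x)"
      using 2(2)[OF w, of "t2 z2 w x"] 2(3)[OF w, of "t1 z1 w x"] by (simp_all only: P'_t1 P'_t2)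
    ultimately have "a w (t1 z1 w x) + b w (t2 z2 w x) =
      (a1 w (w *\<^sub>C U' (P x) - z1 *\<^sub>C P x) + b1 w (U (P x) - z2 *\<^sub>C P x)) +
      (a2 w (w *\<^sub>C U (P' x) - z2 *\<^sub>C P' x) + b2 w (U' (P' x) - z1 *\<^sub>C P' x))"
      by (simp only: a_def b_def) (simp only: add_ac)
    also have "\<dots> = P (P x) + P' (P' x)"
      by (simp only: 1(1)[OF w] 2(1)[OF w])
    also have "\<dots> = x" by (simp add: lin)
    finally show "a w (t1 z1 w x) + b w (t2 z2 w x) = x" .
    show "a w (t1 z1 w x) = t1 z1 w (a w x)"
      using 1(4)[OF w bcl_t1[of w z1], OF t_commutes(1,3)] 2(4)[OF w bcl_t1[of w z1], OF t_commutes(2,4)]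
      unfolding a_def bcl_add[OF bcl_t1] by metis
    show "b w (t1 z1 w x) = t1 z1 w (b w x)"
      using 1(4)[OF w bcl_t1[of w z1], OF t_commutes(1,3)] 2(4)[OF w bcl_t1[of w z1], OF t_commutes(2,4)]
      unfolding b_def bcl_add[OF bcl_t1] by metis
    show "a w (t2 z2 w x) = t2 z2 w (a w x)"
      using 1(4)[OF w bcl_t2[of w z2], OF t_commutes(5,7)] 2(4)[OF w bcl_t2[of w z2], OF t_commutes(6,8)]
      unfolding a_def bcl_add[OF bcl_t2] by metis
    show "b w (t2 z2 w x) = t2 z2 w (b w x)"
      using 1(4)[OF w bcl_t2[of w z2], OF t_commutes(5,7)] 2(4)[OF w bcl_t2[of w z2], OF t_commutes(6,8)]
      unfolding b_def bcl_add[OF bcl_t2] by metis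
  next
    fix f :: "complex \<Rightarrow> 'e"
    assume z: "(z1, z2) \<notin> cball 0 1 \<times> \<sigma>\<^sub>1 \<union> \<sigma>\<^sub>2 \<times> cball 0 1" and f: "f \<in> hardy2"
    have "mult_op a f = mult_op a1 f + mult_op b2 f" "mult_op b f = mult_op b1 f + mult_op a2 f"
      by (auto simp: fun_eq_iff mult_op_apply a_def b_def)
    moreover have "(z1, z2) \<notin> cball 0 1 \<times> \<sigma>\<^sub>1" "(z2, z1) \<notin> cball 0 1 \<times> \<sigma>\<^sub>2" using z by auto
    ultimately show "mult_op a f \<in> hardy2 \<and> mult_op b f \<in> hardy2"
      using 1(5)[OF _ f] 2(5)[OF _ f] by (simp add: hardy2_add)
  qed
qed

text \<open>Outside the set on the right, the inverse families give exactness in every fibre. A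
  point \<open>(z1, z2)\<close> inside is found in the fibre over \<open>z1 * z2\<close>, for either
  summand: spectral values have modulus 1, so this product lies in the open disc.\<close>

lemma taylor_spec_UN:
  "(\<Union>w\<in>ball 0 1. taylor_spec (phi1 P U w) (phi2 P U w)) = ball 0 1 \<times> \<sigma>\<^sub>1 \<union> \<sigma>\<^sub>2 \<times> ball 0 1"
proof (intro equalityI subsetI)
  fix p assume "p \<in> (\<Union>w\<in>ball 0 1. taylor_spec (phi1 P U w) (phi2 P U w))"
  then obtain w z1 z2 where w: "w \<in> ball 0 1" and p: "p = (z1, z2)"
    and ne: "\<not> koszul_exact_on UNIV (t1 z1 w) (t2 z2 w)"
    by (auto simp: taylor_spec_def joint_spec_on_def)
  show "p \<in> ball 0 1 \<times> \<sigma>\<^sub>1 \<union> \<sigma>\<^sub>2 \<times> ball 0 1"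
  proof (rule ccontr)
    assume "p \<notin> ball 0 1 \<times> \<sigma>\<^sub>1 \<union> \<sigma>\<^sub>2 \<times> ball 0 1"
    then obtain a b where
      ab: "a w (t1 z1 w x) + b w (t2 z2 w x) = x"
      "a w (t1 z1 w x) = t1 z1 w (a w x)" "a w (t2 z2 w x) = t2 z2 w (a w x)"
      "b w (t1 z1 w x) = t1 z1 w (b w x)" "b w (t2 z2 w x) = t2 z2 w (b w x)" for x
      unfolding p by (rule complement_inverse) (use w in blast)
    have "koszul_exact_on UNIV (t1 z1 w) (t2 z2 w)"
      by (rule koszul_exactI[where A = "a w" and B = "b w"])
        (rule UNIV_I ab t1_t2 bcl_add[OF bcl_t1] bcl_add[OF bcl_t2] bcl_minus[OF bcl_t2])+
    then show False using ne by simp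
  qed
next
  fix p assume pin: "p \<in> ball 0 1 \<times> \<sigma>\<^sub>1 \<union> \<sigma>\<^sub>2 \<times> ball 0 1"
  obtain z1 z2 where p: "p = (z1, z2)" by force
  have breaks: "p \<in> (\<Union>w\<in>ball 0 1. taylor_spec (phi1 P U w) (phi2 P U w))"
    if w: "w \<in> ball 0 1" and e: "\<And>x y. e \<noteq> t1 z1 w x + t2 z2 w y" for w e
  proof -
    have "e \<notin> {t1 z1 w x + t2 z2 w y | x y. x \<in> UNIV \<and> y \<in> UNIV}" using e by blast
    then have "koszul_breaks_stage3_on UNIV (t1 z1 w) (t2 z2 w)"
      unfolding koszul_breaks_stage3_on_def by blast
    then have "\<not> koszul_exact_on UNIV (t1 z1 w) (t2 z2 w)"
      using koszul_exact_imp_not_breaks[of UNIV "t1 z1 w" "t2 z2 w"] bcl_minus[OF bcl_t2] by blast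
    then show ?thesis using w by (auto simp: p taylor_spec_def joint_spec_on_def)
  qed
  consider "cmod z1 < 1" "z2 \<in> \<sigma>\<^sub>1" | "cmod z2 < 1" "z1 \<in> \<sigma>\<^sub>2"
    using pin unfolding p by auto
  then show "p \<in> (\<Union>w\<in>ball 0 1. taylor_spec (phi1 P U w) (phi2 P U w))"
  proof cases
    case 1
    obtain e where e: "\<And>x y. P e \<noteq> ((z1 * z2) *\<^sub>C U' (P x) - z1 *\<^sub>C P x) + (U (P y) - z2 *\<^sub>C P y)"
      by (rule R1.not_surj_interior[OF 1(2), of z1]) blast
    show ?thesis
    proof (rule breaks[of "z1 * z2" e])
      show "z1 * z2 \<in> ball 0 1" using 1 R1.norm_spec by (simp add: norm_mult)
      show "e \<noteq> t1 z1 (z1 * z2) x + t2 z2 (z1 * z2) y" for x y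
        using e[of x y] P_t1[of "z1 * z2" x z1] P_t2[of "z1 * z2" y z2]
        by (metis bcl_add[OF bcl_P])
    qed
  next
    case 2
    obtain e where e: "\<And>x y. P' e \<noteq> ((z2 * z1) *\<^sub>C U (P' x) - z2 *\<^sub>C P' x) + (U' (P' y) - z1 *\<^sub>C P' y)"
      by (rule R2.not_surj_interior[OF 2(2), of z2]) blast
    show ?thesis
    proof (rule breaks[of "z2 * z1" e])
      show "z2 * z1 \<in> ball 0 1" using 2 R2.norm_spec by (simp add: norm_mult)
      show "e \<noteq> t1 z1 (z2 * z1) x + t2 z2 (z2 * z1) y" for x y
        using e[of y x] P'_t1[of "z2 * z1" x z1] P'_t2[of "z2 * z1" y z2]
          bcl_add[OF R2.bcl_Q, of "t1 z1 (z2 * z1) x" "t2 z2 (z2 * z1) y"]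
        by (metis add.commute)
    qed
  qed
qed

lemma closure_taylor_spec_UN:
  "closure (\<Union>w\<in>ball 0 1. taylor_spec (phi1 P U w) (phi2 P U w)) = cball 0 1 \<times> \<sigma>\<^sub>1 \<union> \<sigma>\<^sub>2 \<times> cball 0 1"
  by (simp add: taylor_spec_UN closure_Un closure_Times closure_closed R1.closed_spec R2.closed_spec)

lemma mult_op_phi_minus:
  assumes "f \<in> hardy2"
  shows "mult_op (phi1 P U) f - fscaleC z f = mult_op (t1 z) f"
    "mult_op (phi2 P U) f - fscaleC z f = mult_op (t2 z) f"
  using assms by (auto simp: fun_eq_iff mult_op_apply fscaleC_def hardy2_outside simp del: mem_ball)

lemma t_in_hardy2:
  assumes "f \<in> hardy2"
  shows "mult_op (t1 z) f \<in> hardy2" "mult_op (t2 z) f \<in> hardy2"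
  using assms by (simp_all add: mult_op_phi_minus[symmetric] hardy2_diff fscaleC_in_hardy2 phi_in_hardy2 P U)

text \<open>The constant function with value \<open>e\<close> is missed: a representation in the
  Hardy space would hold at every \<open>w\<close>, against the choice of \<open>e\<close>. Since
  the closed discs are covered, this serves both the spectrum and the assertion on stage 3.\<close>

lemma hardy_breaks:
  assumes "(z1, z2) \<in> cball 0 1 \<times> \<sigma>\<^sub>1 \<union> \<sigma>\<^sub>2 \<times> cball 0 1"
  shows "koszul_breaks_stage3_on hardy2 (\<lambda>f. mult_op (phi1 P U) f - fscaleC z1 f)
    (\<lambda>f. mult_op (phi2 P U) f - fscaleC z2 f)"
proof -
  have breaks: ?thesis
    if e: "\<And>g h. g \<in> hardy2 \<Longrightarrow> h \<in> hardy2 \<Longrightarrow> \<exists>w\<in>ball 0 1. e \<noteq> t1 z1 w (g w) + t2 z2 w (h w)" for e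
  proof -
    have "hardy_const e \<notin> {(mult_op (phi1 P U) f - fscaleC z1 f) + (mult_op (phi2 P U) g - fscaleC z2 g)
        | f g. f \<in> hardy2 \<and> g \<in> hardy2}"
    proof
      assume "hardy_const e \<in> {(mult_op (phi1 P U) f - fscaleC z1 f) + (mult_op (phi2 P U) g - fscaleC z2 g)
        | f g. f \<in> hardy2 \<and> g \<in> hardy2}"
      then obtain g h where gh: "g \<in> hardy2" "h \<in> hardy2"
        "hardy_const e = mult_op (t1 z1) g + mult_op (t2 z2) h"
        using mult_op_phi_minus by fastforce
      obtain w where w: "w \<in> ball 0 1" "e \<noteq> t1 z1 w (g w) + t2 z2 w (h w)"
        using e[OF gh(1,2)] by blast
      show False using fun_cong[OF gh(3), of w] w by (simp add: hardy_const_def mult_op_apply)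
    qed
    then show ?thesis unfolding koszul_breaks_stage3_on_def using hardy_const_in by blast
  qed
  consider "cmod z1 \<le> 1" "z2 \<in> \<sigma>\<^sub>1" | "cmod z2 \<le> 1" "z1 \<in> \<sigma>\<^sub>2" using assms by auto
  then show ?thesis
  proof cases
    case 1
    obtain e where e: "\<And>g h. g \<in> hardy2 \<Longrightarrow> h \<in> hardy2 \<Longrightarrow>
      \<exists>w\<in>ball 0 1. P e \<noteq> (w *\<^sub>C U' (P (g w)) - z1 *\<^sub>C P (g w)) + (U (P (h w)) - z2 *\<^sub>C P (h w))"
      by (rule R1.not_surj_hardy[OF 1(2,1)]) blast
    show ?thesis
    proof (rule breaks)
      show "\<exists>w\<in>ball 0 1. e \<noteq> t1 z1 w (g w) + t2 z2 w (h w)" if gh: "g \<in> hardy2" "h \<in> hardy2" for g h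
        using e[OF gh] by (metis bcl_add[OF bcl_P] P_t1 P_t2)
    qed
  next
    case 2
    obtain e where e: "\<And>g h. g \<in> hardy2 \<Longrightarrow> h \<in> hardy2 \<Longrightarrow>
      \<exists>w\<in>ball 0 1. P' e \<noteq> (w *\<^sub>C U (P' (g w)) - z2 *\<^sub>C P' (g w)) + (U' (P' (h w)) - z1 *\<^sub>C P' (h w))"
      by (rule R2.not_surj_hardy[OF 2(2,1)]) blast
    show ?thesis
    proof (rule breaks)
      show "\<exists>w\<in>ball 0 1. e \<noteq> t1 z1 w (g w) + t2 z2 w (h w)" if gh: "g \<in> hardy2" "h \<in> hardy2" for g h
      proof -
        obtain w where w: "w \<in> ball 0 1" 
          "P' e \<noteq> (w *\<^sub>C U (P' (h w)) - z2 *\<^sub>C P' (h w)) + (U' (P' (g w)) - z1 *\<^sub>C P' (g w))"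
          using e[OF gh(2,1)] by blast
        have "P' (t1 z1 w (g w) + t2 z2 w (h w)) =
          (w *\<^sub>C U (P' (h w)) - z2 *\<^sub>C P' (h w)) + (U' (P' (g w)) - z1 *\<^sub>C P' (g w))"
          using P'_t1[of w "g w" z1] P'_t2[of w "h w" z2]
            bcl_add[OF R2.bcl_Q, of "t1 z1 w (g w)" "t2 z2 w (h w)"]
          by (simp only: add.commute)
        then have "e \<noteq> t1 z1 w (g w) + t2 z2 w (h w)" using w(2) by metis
        then show ?thesis using w(1) by blast
      qed
    qed
  qed
qed

lemma joint_spec_hardy:
  "joint_spec_on fscaleC hardy2 (mult_op (phi1 P U)) (mult_op (phi2 P U)) =
    cball 0 1 \<times> \<sigma>\<^sub>1 \<union> \<sigma>\<^sub>2 \<times> cball 0 1"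
proof -
  have "koszul_exact_on hardy2 (\<lambda>f. mult_op (phi1 P U) f - fscaleC z1 f)
      (\<lambda>f. mult_op (phi2 P U) f - fscaleC z2 f) \<longleftrightarrow> (z1, z2) \<notin> cball 0 1 \<times> \<sigma>\<^sub>1 \<union> \<sigma>\<^sub>2 \<times> cball 0 1"
    for z1 z2
  proof
    assume ex: "koszul_exact_on hardy2 (\<lambda>f. mult_op (phi1 P U) f - fscaleC z1 f)
      (\<lambda>f. mult_op (phi2 P U) f - fscaleC z2 f)"
    have "mult_op (phi2 P U) (- f) - fscaleC z2 (- f) = - (mult_op (phi2 P U) f - fscaleC z2 f)" for f
      by (auto simp: fun_eq_iff mult_op_apply fscaleC_def bcl_minus[OF bcl_phi2])
    with ex show "(z1, z2) \<notin> cball 0 1 \<times> \<sigma>\<^sub>1 \<union> \<sigma>\<^sub>2 \<times> cball 0 1"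
      using hardy_breaks koszul_exact_imp_not_breaks hardy2_minus by blast
  next
    assume z: "(z1, z2) \<notin> cball 0 1 \<times> \<sigma>\<^sub>1 \<union> \<sigma>\<^sub>2 \<times> cball 0 1"
    \<comment> \<open>The families exist under this weaker open-disc condition; \<open>z\<close>
      itself is needed again to keep \<open>hardy2\<close> invariant.\<close>
    then have z': "(z1, z2) \<notin> ball 0 1 \<times> \<sigma>\<^sub>1 \<union> \<sigma>\<^sub>2 \<times> ball 0 1" by auto
    have "koszul_exact_on hardy2 (mult_op (t1 z1)) (mult_op (t2 z2))"
    proof (rule complement_inverse[OF z'], goal_cases)
      case (1 a b)
      show ?case
        by (rule hardy_koszul_exact[where a = a and b = b])
          (rule bcl_t1 bcl_t2 t_in_hardy2 t1_t2 | erule 1(1-5) | use 1(6)[OF z] in blast)+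
    qed
    then show "koszul_exact_on hardy2 (\<lambda>f. mult_op (phi1 P U) f - fscaleC z1 f)
      (\<lambda>f. mult_op (phi2 P U) f - fscaleC z2 f)"
      by (subst koszul_exact_on_cong[OF mult_op_phi_minus]) auto
  qed
  then show ?thesis by (auto simp: joint_spec_on_def)
qed

lemma reduces_P: "reduces (range P) U" "reduces (range P') U"
proof -
  have "U (P x) \<in> range P" "U' (P x) \<in> range P" for x
    by (simp_all add: R1.QV[symmetric] R1.QV'[symmetric])
  then show "reduces (range P) U" by (auto simp: reduces_def)
  have "U (P' x) \<in> range P'" "U' (P' x) \<in> range P'" for x
    unfolding R2.QV[symmetric] R2.QV'[symmetric] by (rule rangeI)+
  then show "reduces (range P') U" by (auto simp: reduces_def)
qed

end

subsection \<open>Consequences of a vanishing defect operator\<close>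

locale bcl_model =
  fixes V1 V2 :: "'h::chilbert \<Rightarrow> 'h" and P U :: "'e::chilbert \<Rightarrow> 'e"
    and Hp :: "'h set" and W :: "'h \<Rightarrow> complex \<Rightarrow> 'e"
  assumes V1: "isometry V1" and V2: "isometry V2" and V1V2: "V1 (V2 x) = V2 (V1 x)"
    and P: "orth_proj P" and U: "unitary U"
    and Hp: "csubspace Hp" and red1: "reduces Hp V1" and red2: "reduces Hp V2"
    and W: "bij_betw W Hp hardy2"
    and W_add: "x \<in> Hp \<Longrightarrow> y \<in> Hp \<Longrightarrow> W (x + y) = W x + W y"
    and W_scale: "x \<in> Hp \<Longrightarrow> W (c *\<^sub>C x) = fscaleC c (W x)"
    and W_norm: "x \<in> Hp \<Longrightarrow> hardy_norm (W x) = norm x"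
    and W_V1: "x \<in> Hp \<Longrightarrow> W (V1 x) = mult_op (phi1 P U) (W x)"
    and W_V2: "x \<in> Hp \<Longrightarrow> W (V2 x) = mult_op (phi2 P U) (W x)"
begin

text \<open>\<open>kern u\<close> corresponds to the Szego kernel at 0 in direction u, so pairing with it evaluates at 0.\<close>
definition kern :: "'e \<Rightarrow> 'h" where "kern u = inv_into Hp W (hardy_const u)"

lemma kern_in: "kern u \<in> Hp" and W_kern: "W (kern u) = hardy_const u"
  using W hardy_const_in[of u] unfolding kern_def bij_betw_def
  by (auto intro: inv_into_into f_inv_into_f)

lemma kern_eqI: "x \<in> Hp \<Longrightarrow> W x = hardy_const u \<Longrightarrow> x = kern u"
  using W W_kern kern_in unfolding bij_betw_def inj_on_def by metis

lemma W_in: "x \<in> Hp \<Longrightarrow> W x \<in> hardy2"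
  using W by (auto simp: bij_betw_def)

lemma norm_kern: "norm (kern u) = norm u"
proof -
  have "norm (kern u) = sqrt (\<Sum>n. (norm (if n = 0 then u else 0))\<^sup>2)"
    using W_norm[OF kern_in, of u] by (simp add: W_kern hardy_norm_eq[OF hardy_coeffs_const])
  also have "(\<lambda>n. (norm (if n = 0 then u else 0))\<^sup>2) = (\<lambda>n. if n = 0 then (norm u)\<^sup>2 else 0)"
    by auto
  also have "(\<Sum>n. if n = 0 then (norm u)\<^sup>2 else 0) = (norm u)\<^sup>2"
    by (rule sums_unique[symmetric]) (rule sums_single)
  finally show ?thesis by simp
qed

text \<open>\<open>W\<close> is given as norm-preserving, so the inner product is recovered by
  polarization: \<open>hardy_norm_add_const\<close> gives the real part, and \<open>\<i> y\<close>
  the imaginary one.\<close>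

lemma cinner_kern: 
  assumes y: "y \<in> Hp"
  shows "cinner (kern u) y = cinner u (W y 0)"
proof -
  have Re: "Re (cinner (kern u) y) = Re (cinner u (W y 0))" if "y \<in> Hp" for y
    using hardy_norm_add_const[OF W_in[OF that], of u] W_norm[OF that] that kern_in[of u]
      W_norm[of "kern u + y"] Hp norm_add_sq[of "kern u" y]
    by (simp add: W_add W_kern norm_kern csubspace_def)
  have "\<i> *\<^sub>C y \<in> Hp" using Hp y by (simp add: csubspace_def)
  from Re[OF this] Re[OF y] show ?thesis
    by (simp add: W_scale[OF y] fscaleC_def cinner_simps complex_eq_iff)
qed

section \<open>The isometries on kernel vectors and on values at 0\<close>

lemma V1_in: "x \<in> Hp \<Longrightarrow> V1 x \<in> Hp" and V2_in: "x \<in> Hp \<Longrightarrow> V2 x \<in> Hp"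
  and adj_V1_in: "x \<in> Hp \<Longrightarrow> adj V1 x \<in> Hp" and adj_V2_in: "x \<in> Hp \<Longrightarrow> adj V2 x \<in> Hp"
  using red1 red2 by (auto simp: reduces_def)

lemma W_V1_0: "x \<in> Hp \<Longrightarrow> W (V1 x) 0 = adj U (W x 0 - P (W x 0))"
  and W_V2_0: "x \<in> Hp \<Longrightarrow> W (V2 x) 0 = P (U (W x 0))"
  by (simp_all add: W_V1 W_V2 mult_op_apply phi1_def phi2_def)

lemmas adj_V1 = adj_cinner[OF isometry_bcl[OF V1]] and adj_V2 = adj_cinner[OF isometry_bcl[OF V2]]
lemmas adj_U = adj_cinner[OF isometry_bcl[OF unitary_isometry[OF U]]]

lemma bcl_P: "bcl P" and PP: "P (P x) = P x" and P_cinner: "cinner (P x) y = cinner x (P y)"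
  using P by (auto simp: orth_proj_def)

text \<open>On vectors \<open>u - P u\<close> the symbol \<open>phi1\<close> is independent of the
  disc variable, so these constants go to constants.\<close>

lemma V1_kern: "V1 (kern (u - P u)) = kern (adj U (u - P u))"
  by (rule kern_eqI) (auto simp: kern_in V1_in W_V1 W_kern mult_op_apply hardy_const_def phi1_def
      bcl_simps[OF bcl_P] PP fun_eq_iff)

lemma V2_kern: "V2 (kern (adj U (P u))) = kern (P u)"
  by (rule kern_eqI) (auto simp: kern_in V2_in W_V2 W_kern mult_op_apply hardy_const_def phi2_def
      PP unitary_adj[OF U] fun_eq_iff)

text \<open>Values at 0 of \<open>V1 y\<close> lie in the image under \<open>adj U\<close> of the
  complement of \<open>ran P\<close>, which is orthogonal to the image of \<open>ran P\<close>. By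
  the reproducing property the kernel vector is orthogonal to \<open>V1 y\<close> for every
  \<open>y\<close> in \<open>Hp\<close>, in particular for its own image under
  \<open>adj V1\<close>.\<close>

lemma adj_V1_kern: "adj V1 (kern (adj U (P u))) = 0"
proof -
  define x where "x = kern (adj U (P u))"
  have x: "adj V1 x \<in> Hp" unfolding x_def by (intro adj_V1_in kern_in)
  define v where "v = W (adj V1 x) 0"
  have "cinner (adj V1 x) (adj V1 x) = cinner (V1 (adj V1 x)) x"
    by (simp add: adj_V1)
  also have "\<dots> = cnj (cinner x (V1 (adj V1 x)))" by (rule cinner_commute)
  also have "cinner x (V1 (adj V1 x)) = cinner (adj U (P u)) (adj U (v - P v))"
    unfolding x_def[symmetric] v_def
    using cinner_kern[OF V1_in[OF x], of "adj U (P u)", folded x_def] W_V1_0[OF x] by simp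
  also have "\<dots> = cinner (P u) (v - P v)"
    by (simp add: adj_U[symmetric] unitary_adj[OF U])
  also have "\<dots> = 0" by (simp add: P_cinner bcl_simps[OF bcl_P] PP)
  finally show ?thesis by (simp add: cinner_eq_zero_iff x_def)
qed

lemma range_P_trivial_of_surj: 
  assumes "surj V1"
  shows "P u = 0"
proof -
  obtain y where y: "kern (adj U (P u)) = V1 y" using assms by (metis surjD)
  then have "y = 0" using adj_V1_kern[of u] by (simp add: isometry_adj[OF V1])
  then have "norm (kern (adj U (P u))) = 0" using y by (simp add: bcl_zero[OF isometry_bcl[OF V1]])
  then have "adj U (P u) = 0" by (simp add: norm_kern)
  then show ?thesis by (metis unitary_adj[OF U] bcl_zero[OF isometry_bcl[OF unitary_isometry[OF U]]])
qed

text \<open>Values at 0 of \<open>V2 y\<close> lie in \<open>ran P\<close>. If \<open>V2\<close> is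
  onto, the kernel vector of \<open>u - P u\<close> has this form, with \<open>y\<close> in
  \<open>Hp\<close> because \<open>Hp\<close> is reducing, so \<open>u - P u\<close> lies in
  \<open>ran P\<close>.\<close>

lemma range_P'_trivial_of_surj: 
  assumes "surj V2"
  shows "u - P u = 0"
proof -
  obtain y where y: "kern (u - P u) = V2 y" using assms by (metis surjD)
  then have "y \<in> Hp" using adj_V2_in[OF kern_in, of "u - P u"] by (simp add: isometry_adj[OF V2])
  from W_V2_0[OF this, folded y] have "u - P u = P (U (W y 0))"
    by (simp add: W_kern hardy_const_def)
  then have "P (u - P u) = u - P u" by (simp add: PP)
  then show ?thesis by (simp add: bcl_simps[OF bcl_P] PP)
qed

text \<open>It suffices that \<open>adj U\<close> maps \<open>ran P\<close> into itself and the
  complement into the kernel of \<open>P\<close>. Each half evaluates the defect equation at a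
  kernel vector, where \<open>adj_V1_kern\<close> makes terms vanish.\<close>

lemma PU_commute:
  assumes C: "defect_op V1 V2 = (\<lambda>x. 0)"
  shows "P (U x) = U (P x)"
proof -
  note V1z = bcl_zero[OF isometry_bcl[OF V1]] and V2z = bcl_zero[OF isometry_bcl[OF V2]]
  have adj0: "adj V1 0 = 0" "adj V2 0 = 0"
    using isometry_adj[OF V1, of 0] isometry_adj[OF V2, of 0] by (simp_all add: V1z V2z)
  have defect: "x - V1 (adj V1 x) - V2 (adj V2 x) + V1 (V2 (adj V2 (adj V1 x))) = 0" for x
    using fun_cong[OF C, of x] by (simp add: defect_op_def)
  have adj_comm: "adj V2 (adj V1 x) = adj V1 (adj V2 x)" for x
    by (rule cinner_eqI) (simp add: adj_V1[symmetric] adj_V2[symmetric] V1V2)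
  \<comment> \<open>Both terms with \<open>adj V1 x\<close> vanish, leaving
    \<open>x = V2 (adj V2 x)\<close>, and values at 0 of such vectors lie in
    \<open>ran P\<close>.\<close>
  have inv: "P (adj U (P u)) = adj U (P u)" for u
  proof -
    define x where "x = kern (adj U (P u))"
    have "x = V2 (adj V2 x)"
      using defect[of x] adj_V1_kern[of u, folded x_def] by (simp add: adj0 V1z V2z)
    moreover have "adj V2 x \<in> Hp" unfolding x_def by (intro adj_V2_in kern_in)
    ultimately have "W x 0 = P (U (W (adj V2 x) 0))" using W_V2_0 by metis
    then have "P (W x 0) = W x 0" by (simp add: PP)
    then show ?thesis by (simp add: x_def W_kern hardy_const_def)
  qed
  \<comment> \<open>For \<open>x = V2 y\<close> the terms \<open>x\<close> and
    \<open>V2 (adj V2 x)\<close> cancel and the last one vanishes because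
    \<open>adj V1 y = 0\<close>. Hence \<open>adj V1 x = 0\<close>, so \<open>x\<close> is
    orthogonal to the kernel vectors that \<open>V1_kern\<close> produces in the range of
    \<open>V1\<close>.\<close>
  have orth: "P (adj U (v - P v)) = 0" for v
  proof -
    have "cinner (adj U (v - P v)) (P u) = 0" for u
    proof -
      define y where "y = kern (adj U (P u))"
      define x where "x = kern (P u)"
      have x: "x = V2 y" by (simp add: x_def y_def V2_kern)
      have y: "adj V1 y = 0" by (simp add: y_def adj_V1_kern)
      have "V1 (adj V1 x) = 0"
        using defect[of x] y by (simp add: adj_comm x isometry_adj[OF V2] V1z V2z)
      then have "adj V1 x = 0" using isometry_adj[OF V1, of "adj V1 x"] adj0 by simp
      then have "cinner (V1 (kern (v - P v))) x = 0" by (simp add: adj_V1)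
      then show ?thesis by (simp add: V1_kern x_def cinner_kern[OF kern_in] W_kern hardy_const_def)
    qed
    then have "cinner (adj U (v - P v)) (P (adj U (v - P v))) = 0" .
    then have "cinner (P (adj U (v - P v))) (P (adj U (v - P v))) = 0"
      by (simp add: P_cinner PP)
    then show ?thesis by (simp add: cinner_eq_zero_iff)
  qed
  note U' = bcl_simps[OF bcl_adj[OF unitary_isometry[OF U]]]
  have "P (adj U v) = adj U (P v)" for v
    using inv[of v] orth[of v] by (simp add: U' bcl_simps[OF bcl_P])
  from this[of "U x"] have "U (P x) = P (U x)"
    by (metis isometry_adj[OF unitary_isometry[OF U]] unitary_adj[OF U])
  then show ?thesis by simp
qed

end

text \<open>On the zero space every \<open>T - c\<close> is a bijection. This removes one of the two
  terms of the union when an isometry is unitary.\<close>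

lemma spec_on_trivial: "(\<And>x. Q x = 0) \<Longrightarrow> T 0 = 0 \<Longrightarrow> spec_on (range Q) T = {}"
  by (simp add: spec_on_def bij_betw_def)

theorem theorem2p9:
  fixes V1 V2 :: "'h::chilbert \<Rightarrow> 'h" and P U :: "'e::chilbert \<Rightarrow> 'e"
  assumes "isometry V1" and "isometry V2" and "V1 \<circ> V2 = V2 \<circ> V1"
    and "defect_op V1 V2 = (\<lambda>x. 0)"
    and "\<exists>x. x \<noteq> 0 \<and> adj (V1 \<circ> V2) x = 0"
    and "bcl_triple V1 V2 P U"
  shows "reduces (range P) U \<and> reduces (range (\<lambda>x. x - P x)) U \<and>
    joint_spec_on fscaleC hardy2 (mult_op (phi1 P U)) (mult_op (phi2 P U))
      = closure (\<Union>z\<in>ball 0 1. taylor_spec (phi1 P U z) (phi2 P U z)) \<and>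
    closure (\<Union>z\<in>ball 0 1. taylor_spec (phi1 P U z) (phi2 P U z))
      = (if unitary V2 then cball 0 1 \<times> spec_on (range P) U
         else if unitary V1 then spec_on (range (\<lambda>x. x - P x)) (adj U) \<times> cball 0 1
         else (cball 0 1 \<times> spec_on (range P) U) \<union> (spec_on (range (\<lambda>x. x - P x)) (adj U) \<times> cball 0 1)) \<and>
    (\<forall>z1 z2. (z1, z2) \<in>
        (if unitary V2 then ball 0 1 \<times> spec_on (range P) U
         else if unitary V1 then spec_on (range (\<lambda>x. x - P x)) (adj U) \<times> ball 0 1
         else (ball 0 1 \<times> spec_on (range P) U) \<union> (spec_on (range (\<lambda>x. x - P x)) (adj U) \<times> ball 0 1))
      \<longrightarrow> koszul_breaks_stage3_on hardy2
            (\<lambda>f. mult_op (phi1 P U) f - fscaleC z1 f) (\<lambda>f. mult_op (phi2 P U) f - fscaleC z2 f))"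
proof -
  obtain Hp Hu W where *: "csubspace Hp" "reduces Hp V1" "reduces Hp V2" "bij_betw W Hp hardy2"
    "\<forall>x\<in>Hp. \<forall>y\<in>Hp. W (x + y) = W x + W y"
    "\<forall>c. \<forall>x\<in>Hp. W (c *\<^sub>C x) = fscaleC c (W x)" "\<forall>x\<in>Hp. hardy_norm (W x) = norm x"
    "\<forall>x\<in>Hp. W (V1 x) = mult_op (phi1 P U) (W x)" "\<forall>x\<in>Hp. W (V2 x) = mult_op (phi2 P U) (W x)"
    and P: "orth_proj P" and U: "unitary U"
    using assms(6) unfolding bcl_triple_def by metis
  interpret bcl_model V1 V2 P U Hp W
    using * P U assms(1,2) fun_cong[OF assms(3)] by unfold_locales (simp_all add: comp_def)
  interpret commuting_bcl P U
    by unfold_locales (rule P U PU_commute[OF assms(4)])+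
  have V2_case: "\<sigma>\<^sub>2 = {}" if "unitary V2"
    using that range_P'_trivial_of_surj
    by (intro spec_on_trivial) (auto simp: unitary_def bcl_zero[OF bcl_U'])
  have V1_case: "\<sigma>\<^sub>1 = {}" if "unitary V1"
    using that range_P_trivial_of_surj
    by (intro spec_on_trivial) (auto simp: unitary_def bcl_zero[OF bcl_U])
  show ?thesis
  proof (intro conjI allI impI)
    show "closure (\<Union>z\<in>ball 0 1. taylor_spec (phi1 P U z) (phi2 P U z)) =
        (if unitary V2 then cball 0 1 \<times> \<sigma>\<^sub>1 else if unitary V1 then \<sigma>\<^sub>2 \<times> cball 0 1
         else (cball 0 1 \<times> \<sigma>\<^sub>1) \<union> (\<sigma>\<^sub>2 \<times> cball 0 1))"
      by (simp add: closure_taylor_spec_UN V1_case V2_case)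
    fix z1 z2
    assume "(z1, z2) \<in> (if unitary V2 then ball 0 1 \<times> \<sigma>\<^sub>1 else if unitary V1 then \<sigma>\<^sub>2 \<times> ball 0 1
      else (ball 0 1 \<times> \<sigma>\<^sub>1) \<union> (\<sigma>\<^sub>2 \<times> ball 0 1))"
    then have "(z1, z2) \<in> cball 0 1 \<times> \<sigma>\<^sub>1 \<union> \<sigma>\<^sub>2 \<times> cball 0 1"
      by (auto split: if_splits)
    then show "koszul_breaks_stage3_on hardy2 (\<lambda>f. mult_op (phi1 P U) f - fscaleC z1 f)
      (\<lambda>f. mult_op (phi2 P U) f - fscaleC z2 f)"
      by (rule hardy_breaks)
  qed (simp_all only: reduces_P joint_spec_hardy closure_taylor_spec_UN)
qed

end
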